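(* Let $s \in (0,1)$. Let $E \subset \mathbb{R}^2$ be a measurable set contained in a half-plane and that satisfies $\mathrm{H}_{s,E} \le 0$ in the viscosity sense. Then, $E$ is a half-plane.
   Context: Inclusions and equalities between sets are understood up to sets of Lebesgue measure zero ($F \subset E$ means $|F \setminus E| = 0$, and $E=F$ means $|E\Delta F|=0$). Every measurable set $E$ is represented, within its class modulo null sets, so that it contains its measure theoretic interior $\{x : |E\cap B_r(x)| = |B_r| \text{ for some } r>0\}$, is disjoint from its measure theoretic exterior $\{x : |E \cap B_r(x)| = 0 \text{ for some } r>0\}$, and its topological boundary is $\partial E = \{x : 0<|E\cap B_r(x)|<|B_r| \text{ for all } r>0\}$. For a measurable set $F \subset \mathbb{R}^{n+1}$ (here $n=1$) and $x \in \partial F$, the fractional $s$-mean curvature is $$\mathrm{H}_{s,F}(x) := \lim_{\varepsilon \to 0^+} \int_{\mathbb{R}^{n+1}\setminus B_\varepsilon(x)} \frac{\chi_{\mathbb{R}^{n+1}\setminus F}(y) - \chi_F(y)}{|x-y|^{n+1+s}}\, dy.$$ Viscosity sense: given a measurable $E \subset \mathbb{R}^{n+1}$ and $x \in \partial E$, one says that $\mathrm{H}_{s,E} \le 0$ at $x$ in the viscosity sense if $|B_r(x)\cap E|>0$ for all $r>0$ and $\mathrm{H}_{s,F}(x) \le 0$ for every set $F \supset E$ such that $x \in \partial F$ and $\partial F$ is of class $C^2$ in a neighbourhood of $x$. If no point is specified, the inequality is required at every $x\in\partial E$. A half-plane is a set of the form $\{x\in\mathbb{R}^2 : x\cdot\omega<a\}$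 with $|\omega|=1$, $a\in\mathbb{R}$.
   Formalization: The set E is additionally assumed not to be of measure zero: a null set lies in every half-plane and satisfies the viscosity condition vacuously (its boundary is empty), yet is not a half-plane. *)

theory Defs
  imports "HOL-Analysis.Analysis"
begin

text \<open>
  Measurable sets are considered modulo Lebesgue null sets. Every notion below depends only on
  the class of a set, so no particular representative has to be chosen.
\<close>

definition ess_subset :: "'a::euclidean_space set \<Rightarrow> 'a set \<Rightarrow> bool" where
  "ess_subset F E \<longleftrightarrow> F - E \<in> null_sets lebesgue"

definition ess_equal :: "'a::euclidean_space set \<Rightarrow> 'a set \<Rightarrow> bool" where
  "ess_equal E F \<longleftrightarrow> (E - F) \<union> (F - E) \<in> null_sets lebesgue"

text \<open>
  The essential boundary is the topological boundary (\<^const>\<open>frontier\<close>) of the representative of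
  \<open>E\<close> that contains the measure theoretic interior of \<open>E\<close> and is disjoint from its measure
  theoretic exterior; for an arbitrary representative it may be strictly smaller than
  \<^const>\<open>frontier\<close>.
\<close>

definition ess_boundary :: "'a::euclidean_space set \<Rightarrow> 'a set" where
  "ess_boundary E = {x. \<forall>r>0. 0 < measure lebesgue (E \<inter> ball x r) \<and>
      measure lebesgue (E \<inter> ball x r) < measure lebesgue (ball x r)}"

text \<open>
  With \<open>'a = \<real>\<^sup>n\<^sup>+\<^sup>1\<close> the exponent is \<open>n + 1 + s\<close>. For \<open>0 < s < 1\<close> the limit exists whenever \<open>x\<close> lies
  on the essential boundary of \<open>F\<close> and that boundary is of class \<open>C\<^sup>2\<close> near \<open>x\<close>, the only case in
  which the value is used; where it does not exist, \<^const>\<open>Lim\<close> is unspecified.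
\<close>

definition frac_mean_curvature :: "real \<Rightarrow> 'a::euclidean_space set \<Rightarrow> 'a \<Rightarrow> real" where
  "frac_mean_curvature s F x =
     Lim (at_right 0) (\<lambda>\<epsilon>. LINT y : - ball x \<epsilon> | lebesgue.
       (indicator (- F) y - indicator F y) / norm (x - y) powr (real DIM('a) + s))"

definition C2_on :: "('a::euclidean_space \<Rightarrow> real) \<Rightarrow> 'a set \<Rightarrow> bool" where
  "C2_on \<phi> U \<longleftrightarrow>
     (\<exists>(\<phi>' :: 'a \<Rightarrow> 'a \<Rightarrow>\<^sub>L real) (\<phi>'' :: 'a \<Rightarrow> 'a \<Rightarrow>\<^sub>L 'a \<Rightarrow>\<^sub>L real).
        (\<forall>y\<in>U. (\<phi> has_derivative blinfun_apply (\<phi>' y)) (at y)) \<and>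
        (\<forall>y\<in>U. (\<phi>' has_derivative blinfun_apply (\<phi>'' y)) (at y)) \<and>
        continuous_on U \<phi>'')"

text \<open>
  \<open>S\<close> is a \<open>C\<^sup>2\<close> hypersurface in a neighbourhood of \<open>x\<close>: near \<open>x\<close> it is the zero set of a \<open>C\<^sup>2\<close>
  function without critical points.
\<close>

definition C2_hypersurface_near :: "'a::euclidean_space set \<Rightarrow> 'a \<Rightarrow> bool" where
  "C2_hypersurface_near S x \<longleftrightarrow>
     (\<exists>U \<phi>. open U \<and> x \<in> U \<and> C2_on \<phi> U \<and>
        (\<forall>y\<in>U. \<not> (\<phi> has_derivative (\<lambda>_. 0)) (at y)) \<and>
        S \<inter> U = {y \<in> U. \<phi> y = 0})"

definition visc_frac_curv_nonpos_at :: "real \<Rightarrow> 'a::euclidean_space set \<Rightarrow> 'a \<Rightarrow> bool" where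
  "visc_frac_curv_nonpos_at s E x \<longleftrightarrow>
     (\<forall>r>0. measure lebesgue (ball x r \<inter> E) > 0) \<and>
     (\<forall>F\<in>sets lebesgue. ess_subset E F \<longrightarrow> x \<in> ess_boundary F \<longrightarrow>
        C2_hypersurface_near (ess_boundary F) x \<longrightarrow> frac_mean_curvature s F x \<le> 0)"

definition visc_frac_curv_nonpos :: "real \<Rightarrow> 'a::euclidean_space set \<Rightarrow> bool" where
  "visc_frac_curv_nonpos s E \<longleftrightarrow> (\<forall>x\<in>ess_boundary E. visc_frac_curv_nonpos_at s E x)"

definition half_plane :: "(real^2) set \<Rightarrow> bool" where
  "half_plane P \<longleftrightarrow> (\<exists>\<omega> a. norm \<omega> = 1 \<and> P = {x. x \<bullet> \<omega> < a})"

end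

theory Submission
  imports Defs
begin

text \<open>
  Let \<open>{y \<bullet> \<omega> < M}\<close> be the smallest half-plane containing \<open>E\<close>. If \<open>E\<close> touches its boundary at a
  point \<open>x\<close>, then \<open>E\<close> enlarged to the half-plane near \<open>x\<close> is an admissible test set, and its curvature
  at \<open>x\<close> is positive unless \<open>E\<close> fills the half-plane.

  Otherwise, by compactness, \<open>E\<close> stays at a distance \<open>\<delta>\<close> below the line over \<open>\<bar>p\<bar> \<le> 1\<close>, where
  \<open>p\<close>, \<open>q\<close> are the coordinates along and across the line. For small \<open>t > 0\<close> lower the barrier
  \<open>q = const + t \<bar>p\<bar> powr b\<close>, \<open>b = s/2\<close>, until it touches \<open>E\<close>; if this happens before the constant
  reaches \<open>M - \<delta>\<close>, the contact point has \<open>\<bar>p\<bar> > 1\<close>. There the barrier is concave, so the region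
  below it may be replaced by the half-plane under the tangent line in a strip around the contact
  point, which contributes nothing to the curvature. The rest contributes a positive amount: to first
  order in \<open>t\<close> the curvature is the fractional Laplacian of order \<open>1 + s > 1\<close> of \<open>\<bar>p\<bar> powr b\<close> on the line,
  and \<open>\<bar>p\<bar> powr b\<close> is strictly superharmonic away from \<open>0\<close> for \<open>0 < b < s\<close>. Hence \<open>E\<close> lies below all
  these barriers; letting \<open>t\<close> tend to \<open>0\<close> contradicts the choice of \<open>M\<close>.
\<close>

section \<open>Fractional powers as barriers on the line\<close>

text \<open>By homogeneity every contact point can be scaled to 1. This is the integrand, on the
  side \<open>z < 1\<close>, of the fractional Laplacian of order \<open>1 + 2 * b\<close> on the
  line applied to \<open>\<bar>z\<bar> powr b\<close> at the point 1.\<close>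

definition profile :: "real \<Rightarrow> real \<Rightarrow> real" where
  "profile b z = (1 - \<bar>z\<bar> powr b) * (1 - z) powr (-(2 + 2 * b))"

lemma continuous_on_profile:
  assumes "0 < b" "c < 1"
  shows "continuous_on {a..c} (profile b)"
  unfolding profile_def using assms by (intro continuous_intros continuous_on_powr') auto

lemma profile_nonneg: "0 < b \<Longrightarrow> \<bar>z\<bar> \<le> 1 \<Longrightarrow> 0 \<le> profile b z"
  unfolding profile_def by (intro mult_nonneg_nonneg) (auto simp: powr_le1)

text \<open>
  The two integrands differ by a nonnegative multiple of \<open>(1 - \<bar>z\<bar> powr b)\<^sup>2\<close>: this is where the
  relation \<open>s = 2 b\<close> between the barrier and the kernel enters. The part of the left-hand integral
  over \<open>[1 - r, 1/(1+r)]\<close> is \<open>O(r powr (1 - 2 b))\<close>, hence harmless for small \<open>r\<close>.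
\<close>

lemma profile_gap:
  assumes b: "0 < b" "b < 1/2"
  obtains r where "0 < r" "r < 1"
    "integral {-1..1/(1+r)} (\<lambda>z. \<bar>z\<bar> powr b * profile b z) < integral {-1..1-r} (profile b)"
proof -
  define q where "q = (\<lambda>z. (1 - \<bar>z\<bar> powr b)\<^sup>2 * (1 - z) powr (-(2 + 2 * b)))"
  \<comment> \<open>The gain is collected on \<open>{-1..0}\<close> only, so \<open>Q\<close> does
    not depend on \<open>r\<close> and can be used to choose it. It is positive because
    \<open>q 0 = 1\<close>.\<close>
  define Q where "Q = integral {-1..0} q"
  have cont: "continuous_on {a..c} q" if "c < 1" for a c
    unfolding q_def using b that by (intro continuous_intros continuous_on_powr') auto
  have qnn: "0 \<le> q z" for z by (simp add: q_def)
  have "Q \<noteq> 0"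
  proof
    assume "Q = 0"
    then have "\<forall>z\<in>{-1..0}. q z = 0"
      unfolding Q_def using cont[of 0 "-1"] qnn by (subst (asm) integral_eq_0_iff) auto
    then have "q 0 = 0" by auto
    then show False using b by (simp add: q_def)
  qed
  moreover have "0 \<le> Q" unfolding Q_def using qnn by (intro integral_nonneg) (auto intro!: integrable_continuous_real cont)
  ultimately have Q: "0 < Q" by simp
  \<comment> \<open>Since \<open>1 - 2 * b > 0\<close>, this choice pushes
    \<open>2 * r powr (1 - 2*b)\<close>, the bound found below for the extra piece of the left-hand
    integral, under \<open>Q/4\<close>.\<close>
  define r where "r = min (1/2) ((Q/8) powr (1 / (1 - 2*b)))"
  have r: "0 < r" "r < 1" using Q by (auto simp: r_def)
  have r2: "2 * r powr (1 - 2*b) \<le> Q/4"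
  proof -
    have "r powr (1 - 2*b) \<le> ((Q/8) powr (1 / (1 - 2*b))) powr (1 - 2*b)"
      using r b by (intro powr_mono2) (auto simp: r_def)
    also have "\<dots> = Q/8" using Q b by (simp add: powr_powr)
    finally show ?thesis by simp
  qed
  have le: "1 - r \<le> 1/(1+r)" using r by (simp add: field_simps)
  have lt1: "1/(1+r) < 1" using r by simp
  define g where "g = (\<lambda>z. \<bar>z\<bar> powr b * profile b z)"
  have contg: "continuous_on {a..c} g" if "c < 1" for a c
    unfolding g_def using b that by (intro continuous_intros continuous_on_profile continuous_on_powr') auto
  have gi: "g integrable_on {a..c}" if "c < 1" for a c
    by (intro integrable_continuous_real contg that)
  have "integral {-1..1/(1+r)} g = integral {-1..1-r} g + integral {1-r..1/(1+r)} g"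
    using r le lt1 gi by (intro Henstock_Kurzweil_Integration.integral_combine[symmetric]) auto
  moreover have "integral {1-r..1/(1+r)} g \<le> 2 * r powr (1 - 2*b)"
  proof -
    have gb: "g z \<le> (r/(1+r)) powr (-(1+2*b))" if z: "z \<in> {1-r..1/(1+r)}" for z
    proof -
      have z01: "0 < z" "z < 1" using z r lt1 by auto
      \<comment> \<open>On the unit interval \<open>1 - z powr b\<close> is at most
        \<open>1 - z\<close>, which cancels one power of the singularity at 1. The remaining order
        \<open>-(1+2*b)\<close> is beaten by the length of the interval, which is of order
        \<open>r\<^sup>2\<close>.\<close>
      have "z powr 1 \<le> z powr b" using z01 b by (intro powr_mono') auto
      then have 1: "1 - z powr b \<le> 1 - z" using z01 by simp
      have "g z = (z powr b * (1 - z powr b)) * (1 - z) powr (-(2 + 2 * b))"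
        using z01 by (simp add: g_def profile_def)
      also have "\<dots> \<le> (1 * (1 - z)) * (1 - z) powr (-(2 + 2 * b))"
        using z01 b 1 by (intro mult_right_mono mult_mono) (auto simp: powr_le1)
      also have "\<dots> = (1 - z) powr 1 * (1 - z) powr (-(2 + 2 * b))" using z01 by simp
      also have "\<dots> = (1 - z) powr (-(1 + 2 * b))" by (subst powr_add[symmetric]) simp
      also have "\<dots> \<le> (r/(1+r)) powr (-(1+2*b))"
      proof (rule powr_mono2')
        show "r / (1+r) \<le> 1 - z" using z r by (simp add: field_simps)
      qed (use r b in auto)
      finally show ?thesis .
    qed
    have len: "1/(1+r) - (1-r) = r\<^sup>2/(1+r)" using r by (simp add: field_simps power2_eq_square)
    have "integral {1-r..1/(1+r)} g \<le> integral {1-r..1/(1+r)} (\<lambda>_. (r/(1+r)) powr (-(1+2*b)))"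
      using gb lt1 by (intro integral_le gi) auto
    also have "\<dots> = r\<^sup>2/(1+r) * (r/(1+r)) powr (-(1+2*b))" using le len by simp
    also have "\<dots> = r powr (1 - 2*b) * (1+r) powr (2*b)"
    proof -
      have "(r/(1+r)) powr (-(1+2*b)) = ((1+r) * (1+r) powr (2*b)) / (r * r powr (2*b))"
        unfolding powr_minus using r by (simp add: powr_divide powr_add)
      moreover have "r powr (1 - 2*b) = r / r powr (2*b)"
        using r by (simp add: powr_diff)
      ultimately show ?thesis using r by (simp add: power2_eq_square)
    qed
    also have "\<dots> \<le> r powr (1 - 2*b) * (2 powr 1)"
    proof (intro mult_left_mono)
      have "(1+r) powr (2*b) \<le> (1+r) powr 1" using r b by (intro powr_mono) auto
      then show "(1+r) powr (2*b) \<le> 2 powr 1" using r by simp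
    qed simp
    finally show ?thesis by simp
  qed
  moreover have "integral {-1..1-r} g = integral {-1..1-r} (profile b) - integral {-1..1-r} q"
  proof -
    have "g = (\<lambda>z. profile b z - q z)"
      by (auto simp: g_def q_def profile_def power2_eq_square algebra_simps)
    then show ?thesis
      using r b by (auto intro!: Henstock_Kurzweil_Integration.integral_diff integrable_continuous_real cont continuous_on_profile)
  qed
  moreover have "Q \<le> integral {-1..1-r} q"
    unfolding Q_def using r qnn cont
    by (intro integral_subset_le) (auto intro!: integrable_continuous_real)
  ultimately have "integral {-1..1/(1+r)} g < integral {-1..1-r} (profile b)" using Q r2 by linarith
  then show ?thesis using that r unfolding g_def by blast
qed


text \<open>Links the substitution rule for absolutely integrable functions with extended
  nonnegative integrals, in which the masses are defined. Integrability after the substitution also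
  yields finiteness before it.\<close>

lemma nn_integral_change_of_variables_1:
  fixes f g g' :: "real \<Rightarrow> real"
  assumes S: "S \<in> sets lebesgue"
    and der: "\<And>z. z \<in> S \<Longrightarrow> (g has_field_derivative g' z) (at z within S)"
    and inj: "inj_on g S"
    and nn: "\<And>p. p \<in> g ` S \<Longrightarrow> 0 \<le> f p"
    and int: "(\<lambda>z. \<bar>g' z\<bar> * f (g z)) absolutely_integrable_on S"
  shows "(\<integral>\<^sup>+p. ennreal (f p) * indicator (g ` S) p \<partial>lborel) = ennreal (integral S (\<lambda>z. \<bar>g' z\<bar> * f (g z)))"
proof -
  have "f absolutely_integrable_on g ` S \<and> integral (g ` S) f = integral S (\<lambda>z. \<bar>g' z\<bar> * f (g z))"
    using has_absolute_integral_change_of_variables_1'[OF S der inj] int by blast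
  then have "(f has_integral integral S (\<lambda>z. \<bar>g' z\<bar> * f (g z))) (g ` S)"
    using set_lebesgue_integral_eq_integral(1) by (metis has_integral_iff)
  then show ?thesis by (intro nn_integral_has_integral_lebesgue' nn)
qed

text \<open>With \<open>mass_below\<close>, the first-order coefficients in \<open>t\<close> of the
  kernel mass between the barrier and the horizontal line through the contact point at abscissa
  \<open>X\<close>. The excised strip has width proportional to \<open>X\<close>, so that both
  masses scale alike.\<close>

definition mass_above :: "real \<Rightarrow> real \<Rightarrow> real \<Rightarrow> ennreal" where
  "mass_above b r X =
    \<integral>\<^sup>+p. ennreal (max 0 (\<bar>p\<bar> powr b - X powr b) * \<bar>p - X\<bar> powr (-(2+2*b))) * indicator {p. r * X \<le> \<bar>p - X\<bar>} p \<partial>lborel"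

definition mass_below :: "real \<Rightarrow> real \<Rightarrow> real \<Rightarrow> ennreal" where
  "mass_below b r X =
    \<integral>\<^sup>+p. ennreal (max 0 (X powr b - \<bar>p\<bar> powr b) * \<bar>p - X\<bar> powr (-(2+2*b))) * indicator {p. r * X \<le> \<bar>p - X\<bar>} p \<partial>lborel"

text \<open>
  The substitutions \<open>p = X z\<close> and \<open>p = X / z\<close> turn the two masses into the integrals of \<open>profile_gap\<close>.
\<close>

lemma barrier_gap:
  assumes b: "0 < b" "b < 1/2"
  obtains r \<theta> where "0 < r" "r < 1" "0 < \<theta>" "\<theta> < 1"
    "\<And>X. 0 < X \<Longrightarrow> mass_above b r X < ennreal \<theta> * mass_below b r X"
proof -
  obtain r where r: "0 < r" "r < 1"
    and gap: "integral {-1..1/(1+r)} (\<lambda>z. \<bar>z\<bar> powr b * profile b z) < integral {-1..1-r} (profile b)"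
    using profile_gap[OF b] by blast
  define P where "P = integral {-1..1-r} (profile b)"
  define N where "N = integral {-1..1/(1+r)} (\<lambda>z. \<bar>z\<bar> powr b * profile b z)"
  have r1: "1/(1+r) < 1" using r by simp
  have contN: "continuous_on {-1..1/(1+r)} (\<lambda>z. \<bar>z\<bar> powr b * profile b z)"
    using b r1 by (intro continuous_intros continuous_on_profile continuous_on_powr') auto
  have "0 \<le> N" unfolding N_def
    using r1 contN b by (intro integral_nonneg) (auto intro!: integrable_continuous_real mult_nonneg_nonneg profile_nonneg)
  moreover have "N < P" using gap by (simp add: P_def N_def)
  ultimately have NP: "0 \<le> N" "N < P" "0 < P" by auto
  \<comment> \<open>The midpoint between \<open>N / P\<close> and 1. The slack
    \<open>\<theta> < 1\<close> later pays for replacing planar distances by horizontal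
    ones.\<close>
  define \<theta> where "\<theta> = (P + N) / (2 * P)"
  have \<theta>: "0 < \<theta>" "\<theta> < 1" "N < \<theta> * P" using NP by (auto simp: \<theta>_def field_simps)
  show ?thesis
  proof (rule that[OF r \<theta>(1,2)])
    fix X :: real assume X: "0 < X"
    \<comment> \<open>The common factor of the two masses: one power of \<open>X\<close> from the
      substitution, \<open>b\<close> from the barrier and \<open>-(2+2*b)\<close> from the
      kernel.\<close>
    define c where "c = X powr (-1-b)"
    have c: "0 < c" using X by (simp add: c_def)
    have cX: "X * (X powr b * X powr (-(2+2*b))) = c"
    proof -
      have "X powr 1 * (X powr b * X powr (-(2+2*b))) = c"
        unfolding c_def powr_add[symmetric] by simp
      then show ?thesis using X by simp
    qed
    \<comment> \<open>The barrier is below its contact value only for \<open>\<bar>p\<bar>\<close>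
      less than \<open>X\<close>, and the excised strip cuts this interval down to
      \<open>{-X..X*(1-r)}\<close>.\<close>
    have "(\<integral>\<^sup>+p. ennreal (max 0 (X powr b - \<bar>p\<bar> powr b) * \<bar>p - X\<bar> powr (-(2+2*b))) * indicator {p. r * X \<le> \<bar>p - X\<bar>} p \<partial>lborel)
      = (\<integral>\<^sup>+p. ennreal ((X powr b - \<bar>p\<bar> powr b) * \<bar>p - X\<bar> powr (-(2+2*b))) * indicator ((*) X ` {-1..1-r}) p \<partial>lborel)"
    proof (intro nn_integral_cong)
      fix p
      have img: "(*) X ` {-1..1-r} = {-X..X*(1-r)}"
        using X r by simp
      show "ennreal (max 0 (X powr b - \<bar>p\<bar> powr b) * \<bar>p - X\<bar> powr (-(2+2*b))) * indicator {p. r * X \<le> \<bar>p - X\<bar>} p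
        = ennreal ((X powr b - \<bar>p\<bar> powr b) * \<bar>p - X\<bar> powr (-(2+2*b))) * indicator ((*) X ` {-1..1-r}) p"
      proof (cases "\<bar>p\<bar> \<le> X")
        case True
        then have "\<bar>p\<bar> powr b \<le> X powr b" using b by (intro powr_mono2) auto
        moreover have "r * X \<le> \<bar>p - X\<bar> \<longleftrightarrow> p \<in> {-X..X*(1-r)}"
        proof -
          have "\<bar>p - X\<bar> = X - p" "-X \<le> p" using True by auto
          then show ?thesis by (auto simp: algebra_simps)
        qed
        ultimately show ?thesis unfolding img by (auto simp: indicator_def)
      next
        case False
        then have "X powr b \<le> \<bar>p\<bar> powr b" using b X by (intro powr_mono2) auto
        moreover have "p \<notin> {-X..X*(1-r)}"
        proof
          assume "p \<in> {-X..X*(1-r)}"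
          moreover have "X * (1 - r) \<le> X * 1" using X r by (intro mult_left_mono) auto
          ultimately show False using False by (auto simp: abs_if split: if_splits)
        qed
        ultimately show ?thesis unfolding img by (auto simp: max_def)
      qed
    qed
    also have "\<dots> = ennreal (integral {-1..1-r} (\<lambda>z. \<bar>X\<bar> * ((X powr b - \<bar>X * z\<bar> powr b) * \<bar>X * z - X\<bar> powr (-(2+2*b)))))"
    proof (rule nn_integral_change_of_variables_1)
      show "((*) X has_real_derivative X) (at z within {-1..1-r})" for z
        by (auto intro!: derivative_eq_intros)
      show "inj_on ((*) X) {-1..1-r}" using X by (auto simp: inj_on_def)
      show "0 \<le> (X powr b - \<bar>p\<bar> powr b) * \<bar>p - X\<bar> powr (-(2+2*b))" if "p \<in> (*) X ` {-1..1-r}" for p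
      proof -
        from that obtain z where "z \<in> {-1..1-r}" and z: "p = X * z" by (rule imageE)
        then have "-1 \<le> z" "z \<le> 1 - r" by auto
        note z = this z
        have "X * \<bar>z\<bar> \<le> X * 1" using z r X by (intro mult_left_mono) auto
        then have "\<bar>p\<bar> powr b \<le> X powr b" using b z X by (intro powr_mono2) (auto simp: abs_mult)
        then show ?thesis by simp
      qed
      show "(\<lambda>z. \<bar>X\<bar> * ((X powr b - \<bar>X * z\<bar> powr b) * \<bar>X * z - X\<bar> powr (-(2+2*b)))) absolutely_integrable_on {-1..1-r}"
        using b X r by (intro absolutely_integrable_continuous_real continuous_intros continuous_on_powr') auto
    qed simp
    also have "integral {-1..1-r} (\<lambda>z. \<bar>X\<bar> * ((X powr b - \<bar>X * z\<bar> powr b) * \<bar>X * z - X\<bar> powr (-(2+2*b)))) = integral {-1..1-r} (\<lambda>z. c * profile b z)"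
    proof (rule integral_cong)
      fix z assume z: "z \<in> {-1..1-r}"
      have "\<bar>X * z - X\<bar> = X * (1 - z)" using z X r by (simp add: algebra_simps abs_if)
      then have e: "\<bar>X * z - X\<bar> powr (-(2+2*b)) = X powr (-(2+2*b)) * (1 - z) powr (-(2+2*b))"
        using z r X by (simp only: powr_mult)
      have "\<bar>X\<bar> * ((X powr b - \<bar>X * z\<bar> powr b) * \<bar>X * z - X\<bar> powr (-(2+2*b)))
          = (X * (X powr b * X powr (-(2+2*b)))) * profile b z"
        unfolding e profile_def using X by (simp add: abs_mult powr_mult algebra_simps)
      then show "\<bar>X\<bar> * ((X powr b - \<bar>X * z\<bar> powr b) * \<bar>X * z - X\<bar> powr (-(2+2*b))) = c * profile b z"
        unfolding cX .
    qed
    also have "\<dots> = c * P" by (simp add: P_def)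
    finally have pos: "(\<integral>\<^sup>+p. ennreal (max 0 (X powr b - \<bar>p\<bar> powr b) * \<bar>p - X\<bar> powr (-(2+2*b))) * indicator {p. r * X \<le> \<bar>p - X\<bar>} p \<partial>lborel)
      = ennreal (c * P)" .
    \<comment> \<open>The inversion \<open>X / z\<close> folds the unbounded region beyond
      \<open>X\<close> into the unit interval, with 0 standing for infinity. The edge
      \<open>X * (1+r)\<close> of the strip becomes \<open>1/(1+r)\<close> rather than
      \<open>1-r\<close>; this is the mismatch of domains tolerated by
      \<open>profile_gap\<close>.\<close>
    define B where "B = {-1<..1/(1+r)} - {0}"
    have img: "(\<lambda>z. X / z) ` B = {..<-X} \<union> {X * (1+r)..}"
    proof (intro set_eqI iffI)
      fix p assume "p \<in> (\<lambda>z. X / z) ` B"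
      then obtain z where "z \<in> B" and z: "p = X / z" by (rule imageE)
      then have "-1 < z" "z \<le> 1/(1+r)" "z \<noteq> 0" by (auto simp: B_def)
      note z = z this
      show "p \<in> {..<-X} \<union> {X * (1+r)..}"
      proof (cases "z < 0")
        case True
        have "X * (-z) < X * 1" using z X by (intro mult_strict_left_mono) auto
        then have "p < -X" unfolding z(1) using True by (simp add: neg_divide_less_eq)
        then show ?thesis by simp
      next
        case False
        then have "z * (1+r) \<le> 1" "0 < z" using z r by (auto simp: field_simps)
        then have "X * (z * (1+r)) \<le> X * 1" using X by (intro mult_left_mono) auto
        then have "X * (1+r) \<le> p" unfolding z(1) using \<open>0 < z\<close>
          by (simp only: pos_le_divide_eq) (simp add: algebra_simps)
        then show ?thesis by simp
      qed
    next
      fix p assume p: "p \<in> {..<-X} \<union> {X * (1+r)..}"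
      have "0 < X * (1+r)" using X r by simp
      then have p0: "p \<noteq> 0" using p X by auto
      have "X / p \<in> B"
      proof (cases "p < -X")
        case True then show ?thesis using X r p0 by (auto simp: B_def field_simps intro: order_trans[of _ 0])
      next
        case False
        then have "X * (1+r) \<le> p" using p by auto
        moreover from this have "0 < p" using \<open>0 < X * (1+r)\<close> by linarith
        ultimately show ?thesis using X r by (auto simp: B_def field_simps)
      qed
      then show "p \<in> (\<lambda>z. X / z) ` B" using p0 X by (intro image_eqI[of _ _ "X/p"]) auto
    qed
    have intN: "(\<lambda>z. \<bar>z\<bar> powr b * profile b z) absolutely_integrable_on B"
      and IN: "integral B (\<lambda>z. \<bar>z\<bar> powr b * profile b z) = N"
    proof -
      have n1: "negligible (B - {-1..1/(1+r)})" "negligible ({-1..1/(1+r)} - B)"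
        by (auto simp: B_def intro: negligible_subset[of "{-1,0}"])
      show "(\<lambda>z. \<bar>z\<bar> powr b * profile b z) absolutely_integrable_on B"
        using absolutely_integrable_continuous_real[OF contN]
        by (rule absolutely_integrable_spike_set) (auto intro: negligible_subset[OF n1(1)] negligible_subset[OF n1(2)])
      show "integral B (\<lambda>z. \<bar>z\<bar> powr b * profile b z) = N"
        unfolding N_def
        by (rule integral_spike_set) (auto intro: negligible_subset[OF n1(1)] negligible_subset[OF n1(2)])
    qed
    \<comment> \<open>The powers of \<open>\<bar>z\<bar>\<close> are \<open>-2\<close> from the
      Jacobian, \<open>2 + 2 * b\<close> from the kernel and \<open>-b\<close> from the barrier.
      Together they leave exactly the weight \<open>\<bar>z\<bar> powr b\<close>.\<close>
    have eqN: "\<bar>- X / z\<^sup>2\<bar> * ((\<bar>X / z\<bar> powr b - X powr b) * \<bar>X / z - X\<bar> powr (-(2+2*b))) = c * (\<bar>z\<bar> powr b * profile b z)"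
      if z: "z \<in> B" for z
    proof -
      have z': "z \<noteq> 0" "0 < \<bar>z\<bar>" "0 < 1 - z" using z r1 by (auto simp: B_def)
      have "X / z - X = X * (1 - z) / z" using z' by (simp add: field_simps)
      then have "\<bar>X / z - X\<bar> = X * (1 - z) / \<bar>z\<bar>" using X z' by (simp add: abs_mult)
      then have e: "\<bar>X / z - X\<bar> powr (-(2+2*b)) = X powr (-(2+2*b)) * (1 - z) powr (-(2+2*b)) * \<bar>z\<bar> powr (2 + 2*b)"
      proof -
        assume *: "\<bar>X / z - X\<bar> = X * (1 - z) / \<bar>z\<bar>"
        have "\<bar>X / z - X\<bar> powr (-(2+2*b)) = X powr (-(2+2*b)) * (1 - z) powr (-(2+2*b)) * (1 / \<bar>z\<bar> powr (-(2+2*b)))"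
          unfolding * powr_divide powr_mult by simp
        also have "1 / \<bar>z\<bar> powr (-(2+2*b)) = \<bar>z\<bar> powr (2+2*b)"
          by (simp only: powr_minus divide_inverse inverse_inverse_eq mult_1_left)
        finally show ?thesis .
      qed
      have e2: "\<bar>z\<bar> powr (2 + 2*b) = z\<^sup>2 * (\<bar>z\<bar> powr b * \<bar>z\<bar> powr b)"
      proof -
        have "\<bar>z\<bar> powr (2 + 2*b) = \<bar>z\<bar> powr 2 * (\<bar>z\<bar> powr b * \<bar>z\<bar> powr b)"
          unfolding powr_add[symmetric] by simp
        then show ?thesis using z' by simp
      qed
      have e3: "\<bar>X / z\<bar> powr b = X powr b / \<bar>z\<bar> powr b" using X by (simp add: powr_divide)
      have "\<bar>- X / z\<^sup>2\<bar> = X / z\<^sup>2" using X by simp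
      then have "\<bar>- X / z\<^sup>2\<bar> * ((\<bar>X / z\<bar> powr b - X powr b) * \<bar>X / z - X\<bar> powr (-(2+2*b)))
         = (X * (X powr b * X powr (-(2+2*b)))) * (\<bar>z\<bar> powr b * profile b z)"
        unfolding e e2 e3 profile_def using z' by (simp add: field_simps)
      then show ?thesis unfolding cX .
    qed
    have "(\<integral>\<^sup>+p. ennreal (max 0 (\<bar>p\<bar> powr b - X powr b) * \<bar>p - X\<bar> powr (-(2+2*b))) * indicator {p. r * X \<le> \<bar>p - X\<bar>} p \<partial>lborel)
      = (\<integral>\<^sup>+p. ennreal ((\<bar>p\<bar> powr b - X powr b) * \<bar>p - X\<bar> powr (-(2+2*b))) * indicator ((\<lambda>z. X / z) ` B) p \<partial>lborel)"
    proof (intro nn_integral_cong)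
      fix p
      show "ennreal (max 0 (\<bar>p\<bar> powr b - X powr b) * \<bar>p - X\<bar> powr (-(2+2*b))) * indicator {p. r * X \<le> \<bar>p - X\<bar>} p
        = ennreal ((\<bar>p\<bar> powr b - X powr b) * \<bar>p - X\<bar> powr (-(2+2*b))) * indicator ((\<lambda>z. X / z) ` B) p"
      proof (cases "X < \<bar>p\<bar>")
        case True
        then have "X powr b \<le> \<bar>p\<bar> powr b" using b X by (intro powr_mono2) auto
        moreover have "r * X < 2 * X" using X r by (intro mult_strict_right_mono) auto
        then have "r * X \<le> \<bar>p - X\<bar> \<longleftrightarrow> p \<in> {..<-X} \<union> {X * (1+r)..}"
        proof (cases "p < 0")
          case True2: True
          have "r * X \<le> \<bar>p - X\<bar>" using True2 True X \<open>r * X < 2 * X\<close> by linarith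
          then show ?thesis using True2 True by auto
        next
          case False
          then have "p - X = \<bar>p - X\<bar>" "\<not> p < - X" using True X by auto
          then show ?thesis by (auto simp: algebra_simps)
        qed
        ultimately show ?thesis unfolding img by (auto simp: indicator_def)
      next
        case False
        then have "\<bar>p\<bar> powr b \<le> X powr b" using b X by (intro powr_mono2) auto
        moreover have "0 < X * r" using X r by simp
        then have "p \<notin> {..<-X} \<union> {X * (1+r)..}" using False by (auto simp: algebra_simps)
        ultimately show ?thesis unfolding img by (auto simp: max_def)
      qed
    qed
    also have "\<dots> = ennreal (integral B (\<lambda>z. \<bar>- X / z\<^sup>2\<bar> * ((\<bar>X / z\<bar> powr b - X powr b) * \<bar>X / z - X\<bar> powr (-(2+2*b)))))"
    proof (rule nn_integral_change_of_variables_1)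
      show "((\<lambda>z. X / z) has_real_derivative - X / z\<^sup>2) (at z within B)" if "z \<in> B" for z
        using that by (auto intro!: derivative_eq_intros simp: B_def power2_eq_square)
      show "inj_on (\<lambda>z. X / z) B" using X by (auto simp: inj_on_def B_def)
      show "0 \<le> (\<bar>p\<bar> powr b - X powr b) * \<bar>p - X\<bar> powr (-(2+2*b))" if "p \<in> (\<lambda>z. X / z) ` B" for p
      proof -
        have "0 < X * r" using X r by simp
        then have "X \<le> \<bar>p\<bar>" using that X unfolding img by (auto simp: algebra_simps)
        then have "X powr b \<le> \<bar>p\<bar> powr b" using b X by (intro powr_mono2) auto
        then show ?thesis by simp
      qed
      show "(\<lambda>z. \<bar>- X / z\<^sup>2\<bar> * ((\<bar>X / z\<bar> powr b - X powr b) * \<bar>X / z - X\<bar> powr (-(2+2*b)))) absolutely_integrable_on B"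
      proof -
        have "(\<lambda>z. c * (\<bar>z\<bar> powr b * profile b z)) absolutely_integrable_on B"
          using set_integrable_mult_right[OF intN, of c] by simp
        moreover have "(\<lambda>z. \<bar>- X / z\<^sup>2\<bar> * ((\<bar>X / z\<bar> powr b - X powr b) * \<bar>X / z - X\<bar> powr (-(2+2*b)))) absolutely_integrable_on B
            \<longleftrightarrow> (\<lambda>z. c * (\<bar>z\<bar> powr b * profile b z)) absolutely_integrable_on B"
          unfolding set_integrable_def using eqN
          by (intro arg_cong[where f="integrable lebesgue"]) (auto simp: fun_eq_iff indicator_def)
        ultimately show ?thesis by blast
      qed
    qed (simp add: B_def)
    also have "integral B (\<lambda>z. \<bar>- X / z\<^sup>2\<bar> * ((\<bar>X / z\<bar> powr b - X powr b) * \<bar>X / z - X\<bar> powr (-(2+2*b))))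
        = integral B (\<lambda>z. c * (\<bar>z\<bar> powr b * profile b z))"
      by (intro integral_cong eqN)
    also have "\<dots> = c * N" by (simp add: IN)
    finally have neg: "(\<integral>\<^sup>+p. ennreal (max 0 (\<bar>p\<bar> powr b - X powr b) * \<bar>p - X\<bar> powr (-(2+2*b))) * indicator {p. r * X \<le> \<bar>p - X\<bar>} p \<partial>lborel)
      = ennreal (c * N)" .
    show "mass_above b r X < ennreal \<theta> * mass_below b r X"
      unfolding mass_above_def mass_below_def pos neg using \<theta> c NP
      by (subst ennreal_mult[symmetric]) (auto intro!: ennreal_lessI simp: mult.left_commute[of \<theta> c])
  qed
qed

section \<open>Lebesgue measure in orthonormal coordinates\<close>

text \<open>A Borel measure is determined by its values on boxes. The preimage of a box is its image
  under \<open>inv R\<close>, which is again orthogonal and preserves volume.\<close>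

lemma lborel_distr_orthogonal_transformation:
  fixes R :: "real^'n::{finite,wellorder} \<Rightarrow> real^'n::_"
  assumes R: "orthogonal_transformation R"
  shows "distr lborel borel R = lborel"
proof (rule lborel_eqI[symmetric])
  have linR: "linear R" using R by (rule orthogonal_transformation_linear)
  have cR: "continuous_on UNIV R" using linR by (simp add: linear_continuous_on linear_linear)
  then have mR[measurable]: "R \<in> borel_measurable borel" by (rule borel_measurable_continuous_onI)
  have bR: "bij R" using R by (rule orthogonal_transformation_bij)
  fix l u :: "real^'n::{finite,wellorder}" assume lu: "\<And>b. b \<in> Basis \<Longrightarrow> l \<bullet> b \<le> u \<bullet> b"
  have o: "orthogonal_transformation (inv R)" using R by (rule orthogonal_transformation_inv)
  have v: "R -` box l u = inv R ` box l u" using bR by (rule bij_vimage_eq_inv_image)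
  have m: "box l u \<in> lmeasurable" by simp
  have "R -` box l u \<in> sets lborel" using measurable_sets[OF mR, of "box l u"] by simp
  then have "emeasure (distr lborel borel R) (box l u) = emeasure lebesgue (inv R ` box l u)"
    by (simp add: emeasure_distr v)
  also have "\<dots> = ennreal (measure lebesgue (inv R ` box l u))"
    using measurable_orthogonal_image[OF o m] by (simp add: emeasure_eq_measure2 fmeasurableD2)
  also have "measure lebesgue (inv R ` box l u) = measure lebesgue (box l u)"
    by (rule measure_orthogonal_image[OF o m])
  also have "ennreal (measure lebesgue (box l u)) = emeasure lborel (box l u)"
    using emeasure_lborel_box_finite[of l u] by (simp add: emeasure_eq_ennreal_measure[of lborel])
  also have "\<dots> = ennreal (\<Prod>b\<in>Basis. (u - l) \<bullet> b)" using lu by (simp add: emeasure_lborel_box_eq)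
  finally show "emeasure (distr lborel borel R) (box l u) = ennreal (\<Prod>b\<in>Basis. (u - l) \<bullet> b)" .
qed simp

text \<open>Carries Fubini's theorem over from the product type to \<open>real^2\<close>.\<close>

lemma lborel_distr_vector2:
  "distr (lborel :: (real \<times> real) measure) borel (\<lambda>(p, q). vector [p, q] :: real^2) = lborel"
proof (rule lborel_eqI[symmetric])
  have eq: "(\<lambda>(p, q). vector [p, q] :: real^2) = (\<lambda>z. fst z *\<^sub>R axis 1 1 + snd z *\<^sub>R axis 2 1)"
    by (auto simp: vec_eq_iff forall_2 axis_def)
  have m[measurable]: "(\<lambda>(p, q). vector [p, q] :: real^2) \<in> borel_measurable borel"
    unfolding eq by (intro borel_measurable_continuous_onI continuous_intros)
  fix l u :: "real^2" assume lu: "\<And>b. b \<in> Basis \<Longrightarrow> l \<bullet> b \<le> u \<bullet> b"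
  have v: "(\<lambda>(p, q). vector [p, q] :: real^2) -` box l u = {l$1<..<u$1} \<times> {l$2<..<u$2}"
    by (auto simp: mem_box_cart forall_2)
  have lu': "l$i \<le> u$i" for i using lu[of "axis i 1"] by (simp add: inner_axis axis_in_Basis_iff)
  have "emeasure (distr (lborel :: (real \<times> real) measure) borel (\<lambda>(p, q). vector [p, q] :: real^2)) (box l u)
    = emeasure (lborel \<Otimes>\<^sub>M lborel) ({l$1<..<u$1} \<times> {l$2<..<u$2})"
    by (subst emeasure_distr) (simp_all add: v lborel_prod)
  also have "\<dots> = ennreal (u$1 - l$1) * ennreal (u$2 - l$2)"
    using lu' by (subst lborel.emeasure_pair_measure_Times) auto
  also have "\<dots> = ennreal ((u$1 - l$1) * (u$2 - l$2))" using lu' by (simp add: ennreal_mult)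
  also have "(u$1 - l$1) * (u$2 - l$2) = (\<Prod>i\<in>UNIV. (u - l) $ i)" by (simp add: UNIV_2)
  also have "\<dots> = (\<Prod>b\<in>Basis. (u - l) \<bullet> b)"
  proof -
    have B: "(Basis :: (real^2) set) = range (\<lambda>i. axis i 1)" by (auto simp: Basis_vec_def)
    show ?thesis by (subst B) (simp add: prod.reindex inj_on_def axis_eq_axis inner_axis)
  qed
  finally show "emeasure (distr (lborel :: (real \<times> real) measure) borel (\<lambda>(p, q). vector [p, q] :: real^2)) (box l u)
     = ennreal (\<Prod>b\<in>Basis. (u - l) \<bullet> b)" .
qed simp

text \<open>The rotation \<open>R\<close> takes the coordinate axes to \<open>e\<close> and
  \<open>\<omega>\<close>, so the integral can be computed along fibres parallel to
  \<open>\<omega>\<close>.\<close>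

lemma nn_integral_orthonormal_frame:
  fixes e \<omega> :: "real^2" and f :: "real^2 \<Rightarrow> ennreal"
  assumes on: "norm e = 1" "norm \<omega> = 1" "e \<bullet> \<omega> = 0"
    and f[measurable]: "f \<in> borel_measurable borel"
  shows "(\<integral>\<^sup>+y. f y \<partial>lborel) = (\<integral>\<^sup>+p. \<integral>\<^sup>+q. f (p *\<^sub>R e + q *\<^sub>R \<omega>) \<partial>lborel \<partial>lborel)"
proof -
  define R where "R = (\<lambda>v::real^2. (v$1) *\<^sub>R e + (v$2) *\<^sub>R \<omega>)"
  have "linear R" unfolding R_def by (auto intro!: linearI simp: algebra_simps)
  moreover have "norm (R v) = norm v" for v
  proof -
    have "e \<bullet> e = 1" "\<omega> \<bullet> \<omega> = 1" "\<omega> \<bullet> e = 0" using on by (auto simp: norm_eq_1 inner_commute)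
    then have "R v \<bullet> R v = v$1 * v$1 + v$2 * v$2" unfolding R_def using on(3)
      by (simp add: inner_add_left inner_add_right)
    also have "\<dots> = v \<bullet> v" by (simp add: inner_vec_def sum_2)
    finally have "R v \<bullet> R v = v \<bullet> v" .
    then show ?thesis by (simp add: norm_eq_sqrt_inner)
  qed
  ultimately have R: "orthogonal_transformation R" by (simp add: orthogonal_transformation)
  have cR: "continuous_on UNIV R" unfolding R_def by (intro continuous_intros)
  have mR[measurable]: "R \<in> borel_measurable borel" using cR by (rule borel_measurable_continuous_onI)
  have eq: "(\<lambda>(p, q). vector [p, q] :: real^2) = (\<lambda>z. fst z *\<^sub>R axis 1 1 + snd z *\<^sub>R axis 2 1)"
    by (auto simp: vec_eq_iff forall_2 axis_def)
  have m[measurable]: "(\<lambda>(p, q). vector [p, q] :: real^2) \<in> borel_measurable borel"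
    unfolding eq by (intro borel_measurable_continuous_onI continuous_intros)
  have "(\<integral>\<^sup>+y. f y \<partial>lborel) = (\<integral>\<^sup>+y. f y \<partial>distr lborel borel R)"
    by (simp add: lborel_distr_orthogonal_transformation[OF R])
  also have "\<dots> = (\<integral>\<^sup>+v. f (R v) \<partial>lborel)" by (subst nn_integral_distr) auto
  also have "\<dots> = (\<integral>\<^sup>+v. f (R v) \<partial>distr (lborel :: (real \<times> real) measure) borel (\<lambda>(p, q). vector [p, q] :: real^2))"
    by (simp add: lborel_distr_vector2)
  also have "\<dots> = (\<integral>\<^sup>+z. f (R ((\<lambda>(p, q). vector [p, q] :: real^2) z)) \<partial>(lborel :: (real \<times> real) measure))"
    by (subst nn_integral_distr) auto
  also have "\<dots> = (\<integral>\<^sup>+z. f (fst z *\<^sub>R e + snd z *\<^sub>R \<omega>) \<partial>(lborel \<Otimes>\<^sub>M lborel))"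
    by (simp add: lborel_prod R_def split_beta)
  also have "\<dots> = (\<integral>\<^sup>+p. \<integral>\<^sup>+q. f (fst (p, q) *\<^sub>R e + snd (p, q) *\<^sub>R \<omega>) \<partial>lborel \<partial>lborel)"
    by (subst lborel.nn_integral_fst[symmetric]) auto
  finally show ?thesis by simp
qed

section \<open>Reflection invariance and integrability at infinity of the kernel\<close>

lemma nn_integral_point_reflection:
  fixes f :: "'a::euclidean_space \<Rightarrow> ennreal"
  assumes [measurable]: "f \<in> borel_measurable borel"
  shows "(\<integral>\<^sup>+y. f (2 *\<^sub>R x - y) \<partial>lborel) = (\<integral>\<^sup>+y. f y \<partial>lborel)"
proof -
  have "(\<integral>\<^sup>+y. f y \<partial>lborel) = (\<integral>\<^sup>+y. f y \<partial>density (distr lborel borel (\<lambda>y. 2 *\<^sub>R x + (-1) *\<^sub>R y)) (\<lambda>_. \<bar>-1::real\<bar>^DIM('a)))"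
    by (subst lborel_affine[of "-1" "2 *\<^sub>R x"]) auto
  also have "\<dots> = (\<integral>\<^sup>+y. f (2 *\<^sub>R x + (-1) *\<^sub>R y) \<partial>lborel)"
    by (subst nn_integral_density) (auto simp: nn_integral_distr)
  finally show ?thesis by simp
qed

text \<open>On the dyadic annulus \<open>A n\<close> the kernel is at most
  \<open>(\<rho> * 2^n) powr (-d)\<close>, while the volume is of order
  \<open>(\<rho> * 2^n)^DIM('a)\<close>. The contributions are dominated by a geometric series of
  ratio \<open>2 powr (-s)\<close>.\<close>

lemma nn_integral_kernel_finite:
  fixes x :: "'a::euclidean_space"
  assumes "0 < s" "0 < \<rho>"
  shows "(\<integral>\<^sup>+y. ennreal (norm (x - y) powr (-(real DIM('a) + s))) * indicator (- ball x \<rho>) y \<partial>lborel) < \<infinity>"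
proof -
  define d where "d = real DIM('a) + s"
  have d: "0 < d" using assms by (simp add: d_def add_nonneg_pos)
  define V where "V = unit_ball_vol (real DIM('a))"
  define A where "A = (\<lambda>n::nat. ball x (\<rho> * 2^(Suc n)) - ball x (\<rho> * 2^n))"
  define c where "c = \<rho> powr (-d) * (V * (2 * \<rho>)^DIM('a))"
  have V: "0 \<le> V" by (simp add: V_def)
  have c: "0 \<le> c" using V assms by (simp add: c_def)
  have piece: "(\<integral>\<^sup>+y. ennreal (norm (x - y) powr (-d)) * indicator (A n) y \<partial>lborel) \<le> ennreal (c * (2 powr (-s)) ^ n)" for n
  proof -
    have "(\<integral>\<^sup>+y. ennreal (norm (x - y) powr (-d)) * indicator (A n) y \<partial>lborel)
      \<le> (\<integral>\<^sup>+y. ennreal ((\<rho> * 2^n) powr (-d)) * indicator (ball x (\<rho> * 2^(Suc n))) y \<partial>lborel)"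
    proof (intro nn_integral_mono)
      fix y show "ennreal (norm (x - y) powr (-d)) * indicator (A n) y
        \<le> ennreal ((\<rho> * 2^n) powr (-d)) * indicator (ball x (\<rho> * 2^(Suc n))) y"
        using assms d by (auto simp: A_def indicator_def dist_norm intro!: ennreal_leI powr_mono2')
    qed
    also have "\<dots> = ennreal ((\<rho> * 2^n) powr (-d)) * emeasure lborel (ball x (\<rho> * 2^(Suc n)))"
      by (subst nn_integral_cmult_indicator) auto
    also have "\<dots> = ennreal ((\<rho> * 2^n) powr (-d)) * ennreal (V * (\<rho> * 2^(Suc n))^DIM('a))"
      using assms by (subst emeasure_ball) (auto simp: V_def)
    also have "\<dots> = ennreal ((\<rho> * 2^n) powr (-d) * (V * (\<rho> * 2^(Suc n))^DIM('a)))"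
      by (rule ennreal_mult[symmetric]) (use assms V in auto)
    also have "(\<rho> * 2^n) powr (-d) * (V * (\<rho> * 2^(Suc n))^DIM('a)) = c * (2 powr (-s)) ^ n"
    proof -
      have "(\<rho> * 2^n) powr (-d) = \<rho> powr (-d) * (2 powr n) powr (-d)"
        using assms by (simp add: powr_mult powr_realpow)
      also have "(2 powr n) powr (-d) = ((2::real)^n) powr (-real DIM('a)) * (2 powr (-s)) ^ n"
        by (simp add: powr_powr d_def algebra_simps powr_add powr_diff powr_realpow[symmetric] powr_minus field_simps)
      also have "((2::real)^n) powr (-real DIM('a)) = 1 / (2^n)^DIM('a)"
        by (simp add: powr_minus powr_realpow field_simps)
      finally show ?thesis by (simp add: c_def power_mult_distrib field_simps)
    qed
    finally show ?thesis .
  qed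
  have "(\<integral>\<^sup>+y. ennreal (norm (x - y) powr (-d)) * indicator (- ball x \<rho>) y \<partial>lborel)
    \<le> (\<integral>\<^sup>+y. (\<Sum>n. ennreal (norm (x - y) powr (-d)) * indicator (A n) y) \<partial>lborel)"
  proof (intro nn_integral_mono)
    fix y show "ennreal (norm (x - y) powr (-d)) * indicator (- ball x \<rho>) y
       \<le> (\<Sum>n. ennreal (norm (x - y) powr (-d)) * indicator (A n) y)"
    proof (cases "y \<in> ball x \<rho>")
      case False
      have "\<exists>n. norm (x - y) < \<rho> * 2^n"
        using real_arch_pow[of 2 "norm (x - y) / \<rho>"] assms by (auto simp: field_simps)
      \<comment> \<open>The first dyadic radius exceeding the distance. It is not the initial one,
        since \<open>y\<close> is outside \<open>ball x \<rho>\<close>, so its predecessor bounds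
        the annulus from inside.\<close>
      define m where "m = (LEAST n. norm (x - y) < \<rho> * 2^n)"
      have m: "norm (x - y) < \<rho> * 2^m" unfolding m_def by (rule LeastI_ex) fact
      have "m \<noteq> 0" using m False by (intro notI) (simp add: dist_norm)
      then obtain n where n: "m = Suc n" by (cases m) auto
      have "\<not> norm (x - y) < \<rho> * 2^n" using not_less_Least[of n "\<lambda>n. norm (x - y) < \<rho> * 2^n"] n unfolding m_def by simp
      then have "y \<in> A n" using m n by (auto simp: A_def dist_norm)
      then have "ennreal (norm (x - y) powr (-d)) * indicator (- ball x \<rho>) y
        \<le> ennreal (norm (x - y) powr (-d)) * indicator (A n) y" using False by simp
      also have "\<dots> \<le> (\<Sum>k. ennreal (norm (x - y) powr (-d)) * indicator (A k) y)"
      proof -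
        define h where "h = (\<lambda>k. ennreal (norm (x - y) powr (-d)) * indicator (A k) y)"
        have "h n \<le> suminf h" using sum_le_suminf[of h "{n}"] by simp
        then show ?thesis by (simp only: h_def)
      qed
      finally show ?thesis .
    qed simp
  qed
  also have "\<dots> = (\<Sum>n. \<integral>\<^sup>+y. ennreal (norm (x - y) powr (-d)) * indicator (A n) y \<partial>lborel)"
  proof (rule nn_integral_suminf)
    fix n
    have [measurable]: "A n \<in> sets borel" by (simp add: A_def)
    show "(\<lambda>y. ennreal (norm (x - y) powr (-d)) * indicator (A n) y) \<in> borel_measurable lborel"
      by measurable
  qed
  also have "\<dots> \<le> (\<Sum>n. ennreal (c * (2 powr (-s)) ^ n))"
    by (intro suminf_le piece) auto
  also have "\<dots> < \<infinity>"
  proof -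
    have "2 powr (-s) < (2::real) powr 0" using assms by (intro powr_less_mono) auto
    then have "summable (\<lambda>n. c * (2 powr (-s)) ^ n)" by (intro summable_mult summable_geometric) auto
    then show ?thesis using c by (subst suminf_ennreal2) auto
  qed
  finally show ?thesis unfolding d_def .
qed

section \<open>Essential support and the fractional kernel\<close>

lemma norm_reflection: "norm (x - (2 *\<^sub>R x - y)) = norm (x - y)" for x y :: "'a::real_normed_vector"
proof -
  have eq: "x - (2 *\<^sub>R x - y) = y - x" by (simp add: scaleR_2)
  show ?thesis unfolding eq by (rule norm_minus_commute)
qed

text \<open>For measurable \<open>E\<close>, the smallest closed set containing \<open>E\<close> up
  to a null set. Contact points are sought here, because compactness arguments need a closed set
  that depends only on the class of \<open>E\<close>.\<close>

definition ess_supp :: "'a::euclidean_space set \<Rightarrow> 'a set" where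
  "ess_supp E = {x. \<forall>r>0. 0 < measure lebesgue (E \<inter> ball x r)}"

lemma lmeasurable_Int_ball:
  assumes "E \<in> sets lebesgue" shows "E \<inter> ball x r \<in> lmeasurable"
  using assms fmeasurable_Int_fmeasurable[of "ball x r" lebesgue E] by (simp add: Int_commute)

lemma null_sets_lebesgue_subset: "N \<in> null_sets lebesgue \<Longrightarrow> A \<subseteq> N \<Longrightarrow> A \<in> null_sets lebesgue"
  by (rule completion.complete2)

lemma closed_ess_supp:
  assumes "E \<in> sets lebesgue" shows "closed (ess_supp E)"
  unfolding closed_def open_contains_ball
proof
  fix x assume "x \<in> - ess_supp E"
  then obtain r where r: "0 < r" "\<not> 0 < measure lebesgue (E \<inter> ball x r)" by (auto simp: ess_supp_def)
  have "y \<notin> ess_supp E" if "y \<in> ball x r" for y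
  proof -
    have "E \<inter> ball y (r - dist x y) \<subseteq> E \<inter> ball x r"
    proof
      fix z assume "z \<in> E \<inter> ball y (r - dist x y)"
      then show "z \<in> E \<inter> ball x r" using dist_triangle[of x z y] by auto
    qed
    then have "measure lebesgue (E \<inter> ball y (r - dist x y)) \<le> measure lebesgue (E \<inter> ball x r)"
      using assms by (intro measure_mono_fmeasurable lmeasurable_Int_ball) (auto simp: lmeasurable_Int_ball fmeasurableD)
    then show ?thesis using r that unfolding ess_supp_def by (auto simp: not_less intro!: exI[of _ "r - dist x y"])
  qed
  then show "\<exists>e>0. ball x e \<subseteq> - ess_supp E" using r by blast
qed

text \<open>Each point of \<open>E\<close> outside the support has a ball that meets
  \<open>E\<close> in a null set. By Lindelof's theorem countably many of these balls
  suffice.\<close>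

lemma ess_subset_ess_supp:
  assumes E: "E \<in> sets lebesgue" shows "ess_subset E (ess_supp E)"
proof -
  define \<F> where "\<F> = {ball x r | x r. E \<inter> ball x r \<in> null_sets lebesgue}"
  obtain \<F>' where F': "\<F>' \<subseteq> \<F>" "countable \<F>'" "\<Union>\<F>' = \<Union>\<F>"
    using Lindelof[of \<F>] by (auto simp: \<F>_def)
  have "E - ess_supp E \<subseteq> \<Union>\<F>"
  proof
    fix x assume "x \<in> E - ess_supp E"
    then obtain r where r: "0 < r" "\<not> 0 < measure lebesgue (E \<inter> ball x r)" by (auto simp: ess_supp_def)
    then have m0: "measure lebesgue (E \<inter> ball x r) = 0" by (simp add: zero_less_measure_iff)
    note lm = lmeasurable_Int_ball[OF E, of x r]
    have "emeasure lebesgue (E \<inter> ball x r) = 0"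
      unfolding emeasure_eq_measure2[OF lm] m0 by simp
    then have "E \<inter> ball x r \<in> null_sets lebesgue" using lm by (intro null_setsI fmeasurableD)
    then show "x \<in> \<Union>\<F>" using r by (force simp: \<F>_def)
  qed
  then have "E - ess_supp E \<subseteq> (\<Union>S\<in>\<F>'. E \<inter> S)" using F'(3) by blast
  moreover have "(\<Union>S\<in>\<F>'. E \<inter> S) \<in> null_sets lebesgue"
    using F'(1) by (intro null_sets_UN' F'(2)) (auto simp: \<F>_def)
  ultimately show ?thesis unfolding ess_subset_def by (rule null_sets_lebesgue_subset[rotated])
qed

lemma ess_supp_subset:
  assumes "ess_subset E C" "closed C" shows "ess_supp E \<subseteq> C"
proof
  fix x assume x: "x \<in> ess_supp E"
  show "x \<in> C"
  proof (rule ccontr)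
    assume "x \<notin> C"
    then obtain r where r: "0 < r" "ball x r \<subseteq> - C"
      using assms(2) unfolding closed_def open_contains_ball by blast
    then have "E \<inter> ball x r \<in> null_sets lebesgue"
      using assms(1) unfolding ess_subset_def by (rule_tac null_sets_lebesgue_subset) auto
    then have "measure lebesgue (E \<inter> ball x r) = 0" by (simp add: null_sets_def measure_def)
    then show False using x r by (auto simp: ess_supp_def)
  qed
qed

section \<open>The kernel as density of a measure, and curvature through it\<close>

definition kernel_measure :: "real \<Rightarrow> 'a::euclidean_space \<Rightarrow> 'a measure" where
  "kernel_measure s x = density lebesgue (\<lambda>y. ennreal (norm (x - y) powr (-(real DIM('a) + s))))"

lemma sets_kernel_measure[simp, measurable_cong]: "sets (kernel_measure s x) = sets lebesgue"
  by (simp add: kernel_measure_def)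

lemma kernel_measurable[measurable]:
  "(\<lambda>y::'a::euclidean_space. norm (x - y) powr c) \<in> borel_measurable borel"
  by measurable

lemma kernel_measurable_lebesgue[measurable]:
  "(\<lambda>y::'a::euclidean_space. norm (x - y) powr c) \<in> borel_measurable lebesgue"
  by (intro measurable_completion) (simp add: kernel_measurable)

lemma emeasure_kernel_measure:
  fixes x :: "'a::euclidean_space"
  assumes "A \<in> sets lebesgue"
  shows "emeasure (kernel_measure s x) A
    = (\<integral>\<^sup>+y. ennreal (norm (x - y) powr (-(real DIM('a) + s))) * indicator A y \<partial>lborel)"
  unfolding kernel_measure_def using assms
  by (subst emeasure_density) (auto simp: nn_integral_completion)

lemma kernel_measure_finite:
  fixes x :: "'a::euclidean_space"
  assumes "0 < s" "0 < \<rho>" "A \<in> sets lebesgue" "A \<inter> ball x \<rho> = {}"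
  shows "emeasure (kernel_measure s x) A < \<infinity>"
proof -
  have "emeasure (kernel_measure s x) A \<le> emeasure (kernel_measure s x) (- ball x \<rho>)"
    using assms by (intro emeasure_mono) auto
  also have "\<dots> < \<infinity>" using nn_integral_kernel_finite[OF assms(1,2), of x]
    by (subst emeasure_kernel_measure) auto
  finally show ?thesis .
qed

text \<open>Reflection in \<open>x\<close> preserves both the kernel and \<open>W\<close> and
  exchanges the two open sides of the hyperplane through \<open>x\<close>, which is itself
  null.\<close>

lemma kernel_measure_half_space:
  fixes x \<nu> :: "'a::euclidean_space"
  assumes W: "W \<in> sets borel" and sym: "\<And>y. 2 *\<^sub>R x - y \<in> W \<longleftrightarrow> y \<in> W" and \<nu>: "\<nu> \<noteq> 0"
  shows "emeasure (kernel_measure s x) W = 2 * emeasure (kernel_measure s x) (W \<inter> {y. y \<bullet> \<nu> < x \<bullet> \<nu>})"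
proof -
  let ?K = "\<lambda>y. ennreal (norm (x - y) powr (-(real DIM('a) + s)))"
  let ?T = "W \<inter> {y. y \<bullet> \<nu> < x \<bullet> \<nu>}" and ?T' = "W \<inter> {y. y \<bullet> \<nu> > x \<bullet> \<nu>}"
  have b: "{y. y \<bullet> \<nu> < x \<bullet> \<nu>} \<in> sets borel" "{y. y \<bullet> \<nu> > x \<bullet> \<nu>} \<in> sets borel"
    by (auto intro!: borel_open open_Collect_less continuous_intros)
  have TW[measurable]: "?T \<in> sets borel" "?T' \<in> sets borel" "W \<in> sets borel" using W b by auto
  have "{y. \<nu> \<bullet> y = x \<bullet> \<nu>} \<in> null_sets lebesgue"
    using negligible_hyperplane[of \<nu> "x \<bullet> \<nu>"] \<nu> by (simp add: negligible_iff_null_sets)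
  moreover have "{y. \<nu> \<bullet> y = x \<bullet> \<nu>} \<in> sets lborel" by (simp add: closed_hyperplane borel_closed)
  ultimately have "{y. \<nu> \<bullet> y = x \<bullet> \<nu>} \<in> null_sets lborel" by (simp add: null_sets_def)
  then have ae: "AE y in lborel. \<nu> \<bullet> y \<noteq> x \<bullet> \<nu>" using AE_not_in by force
  have "emeasure (kernel_measure s x) W = (\<integral>\<^sup>+y. ?K y * indicator ?T y + ?K y * indicator ?T' y \<partial>lborel)"
    using W ae
    by (subst emeasure_kernel_measure) (auto intro!: nn_integral_cong_AE elim!: eventually_mono simp: indicator_def inner_commute)
  also have "\<dots> = (\<integral>\<^sup>+y. ?K y * indicator ?T y \<partial>lborel) + (\<integral>\<^sup>+y. ?K y * indicator ?T' y \<partial>lborel)"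
    by (rule nn_integral_add) auto
  also have "(\<integral>\<^sup>+y. ?K y * indicator ?T' y \<partial>lborel) = (\<integral>\<^sup>+y. ?K (2 *\<^sub>R x - y) * indicator ?T' (2 *\<^sub>R x - y) \<partial>lborel)"
    by (rule nn_integral_point_reflection[symmetric]) auto
  also have "\<dots> = (\<integral>\<^sup>+y. ?K y * indicator ?T y \<partial>lborel)"
  proof (intro nn_integral_cong)
    fix y
    have "norm (x - (2 *\<^sub>R x - y)) = norm (x - y)"
      by (rule norm_reflection)
    moreover have "(2 *\<^sub>R x - y) \<bullet> \<nu> > x \<bullet> \<nu> \<longleftrightarrow> y \<bullet> \<nu> < x \<bullet> \<nu>" by (auto simp: algebra_simps)
    ultimately show "?K (2 *\<^sub>R x - y) * indicator ?T' (2 *\<^sub>R x - y) = ?K y * indicator ?T y"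
      by (auto simp: indicator_def sym)
  qed
  also have "\<dots> = emeasure (kernel_measure s x) ?T" by (subst emeasure_kernel_measure) auto
  finally show ?thesis by (simp add: mult_2)
qed

text \<open>Inside the symmetric set \<open>S\<close> the half-space and its complement cancel.
  Hence the truncated integral is constant for \<open>\<epsilon> < \<rho>\<close>, and the principal
  value is the contribution from outside \<open>S\<close>.\<close>

lemma frac_mean_curvature_flat:
  fixes x \<nu> :: "'a::euclidean_space"
  assumes s: "0 < s" and \<rho>: "0 < \<rho>" "ball x \<rho> \<subseteq> S" and S: "S \<in> sets borel"
    and sym: "\<And>y. 2 *\<^sub>R x - y \<in> S \<longleftrightarrow> y \<in> S" and \<nu>: "\<nu> \<noteq> 0"
    and F: "F \<in> sets lebesgue" and FS: "F \<inter> S = {y. y \<bullet> \<nu> < x \<bullet> \<nu>} \<inter> S"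
  shows "frac_mean_curvature s F x
    = measure (kernel_measure s x) (- S) - 2 * measure (kernel_measure s x) (F - S)"
proof -
  let ?\<mu> = "kernel_measure s x"
  let ?k = "\<lambda>y. norm (x - y) powr (-(real DIM('a) + s))"
  define T where "T = {y. y \<bullet> \<nu> < x \<bullet> \<nu>}"
  have T: "T \<in> sets borel" unfolding T_def by (auto intro!: borel_open open_Collect_less continuous_intros)
  have val: "(LINT y : - ball x \<epsilon> | lebesgue. (indicator (- F) y - indicator F y) / norm (x - y) powr (real DIM('a) + s))
      = measure ?\<mu> (- S) - 2 * measure ?\<mu> (F - S)" if \<epsilon>: "0 < \<epsilon>" "\<epsilon> < \<rho>" for \<epsilon>
  proof -
    have fin: "emeasure ?\<mu> A \<noteq> \<infinity>" if "A \<in> sets lebesgue" "A \<inter> ball x \<epsilon> = {}" for A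
      using kernel_measure_finite[OF s \<epsilon>(1) that] by auto
    have int: "integrable lebesgue (\<lambda>y. ?k y * indicator A y)"
      and I: "(\<integral>y. ?k y * indicator A y \<partial>lebesgue) = measure ?\<mu> A"
      if A: "A \<in> sets lebesgue" "A \<inter> ball x \<epsilon> = {}" for A
    proof -
      have nn: "(\<integral>\<^sup>+y. ennreal (?k y * indicator A y) \<partial>lebesgue) = emeasure ?\<mu> A"
        unfolding emeasure_kernel_measure[OF A(1)]
        by (subst nn_integral_completion) (auto intro!: nn_integral_cong simp: indicator_def)
      have m: "(\<lambda>y. ?k y * indicator A y) \<in> borel_measurable lebesgue"
        using A by (intro borel_measurable_times kernel_measurable_lebesgue borel_measurable_indicator) auto
      show "integrable lebesgue (\<lambda>y. ?k y * indicator A y)"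
      proof (rule integrableI_nonneg[OF m])
        show "(\<integral>\<^sup>+y. ennreal (?k y * indicator A y) \<partial>lebesgue) < \<infinity>"
          unfolding nn using fin[OF A] by (simp add: less_top)
      qed simp
      show "(\<integral>y. ?k y * indicator A y \<partial>lebesgue) = measure ?\<mu> A"
        using nn by (subst integral_eq_nn_integral[OF m]) (simp_all add: measure_def)
    qed
    let ?B = "ball x \<epsilon>"
    have Bl: "?B \<in> sets lebesgue" by simp
    have BS: "?B \<subseteq> S" using subset_ball[of \<epsilon> \<rho> x] \<epsilon>(2) \<rho>(2) by simp
    have Sl: "S \<in> sets lebesgue" "T \<in> sets lebesgue" using S T by auto
    \<comment> \<open>The difference of the two indicators is 1 minus twice the indicator of
      \<open>F\<close>. All terms are finite because the ball around the singularity has been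
      removed.\<close>
    have "(LINT y : - ?B | lebesgue. (indicator (- F) y - indicator F y) / norm (x - y) powr (real DIM('a) + s))
      = (\<integral>y. ?k y * indicator (- ?B) y - 2 * (?k y * indicator (F - ?B) y) \<partial>lebesgue)"
      unfolding set_lebesgue_integral_def powr_minus
      by (intro Bochner_Integration.integral_cong) (auto simp: indicator_def divide_inverse)
    also have "\<dots> = measure ?\<mu> (- ?B) - 2 * measure ?\<mu> (F - ?B)"
    proof -
      have B: "- ?B \<in> sets lebesgue" "- ?B \<inter> ?B = {}" "F - ?B \<in> sets lebesgue" "(F - ?B) \<inter> ?B = {}"
        using F by auto
      show ?thesis
        unfolding I[OF B(1,2), symmetric] I[OF B(3,4), symmetric]
          Bochner_Integration.integral_mult_right[OF int[OF B(3,4)], symmetric]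
        by (rule Bochner_Integration.integral_diff[OF int[OF B(1,2)] integrable_mult_right[OF int[OF B(3,4)]]])
    qed
    also have "measure ?\<mu> (- ?B) = measure ?\<mu> (S - ?B) + measure ?\<mu> (- S)"
    proof -
      have eq: "- ?B = (S - ?B) \<union> (- S)" using BS by auto
      have un: "measure ?\<mu> ((S - ?B) \<union> (- S)) = measure ?\<mu> (S - ?B) + measure ?\<mu> (- S)"
      proof (rule measure_Union)
        show "emeasure ?\<mu> (S - ?B) \<noteq> \<infinity>" using Sl by (intro fin) auto
        show "emeasure ?\<mu> (- S) \<noteq> \<infinity>" using Sl BS by (intro fin) (auto simp: Compl_in_sets_lebesgue)
      qed (use Sl in \<open>auto simp: Compl_in_sets_lebesgue\<close>)
      show ?thesis by (rule trans[OF arg_cong[where f="measure ?\<mu>", OF eq] un])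
    qed
    also have "measure ?\<mu> (F - ?B) = measure ?\<mu> ((S - ?B) \<inter> T) + measure ?\<mu> (F - S)"
    proof -
      have eq: "F - ?B = ((S - ?B) \<inter> T) \<union> (F - S)" using BS FS by (auto simp: T_def)
      have un: "measure ?\<mu> (((S - ?B) \<inter> T) \<union> (F - S)) = measure ?\<mu> ((S - ?B) \<inter> T) + measure ?\<mu> (F - S)"
      proof (rule measure_Union)
        show "emeasure ?\<mu> ((S - ?B) \<inter> T) \<noteq> \<infinity>" using Sl Bl by (intro fin sets.Int sets.Diff) auto
        show "emeasure ?\<mu> (F - S) \<noteq> \<infinity>" using Sl F BS by (intro fin sets.Diff) auto
      qed (auto intro: sets.Int[OF sets.Diff[OF Sl(1) Bl] Sl(2)] sets.Diff[OF F Sl(1)])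
      show ?thesis by (rule trans[OF arg_cong[where f="measure ?\<mu>", OF eq] un])
    qed
    also have "measure ?\<mu> (S - ?B) = 2 * measure ?\<mu> ((S - ?B) \<inter> T)"
    proof -
      have "emeasure ?\<mu> (S - ?B) = 2 * emeasure ?\<mu> ((S - ?B) \<inter> T)"
        unfolding T_def
      proof (rule kernel_measure_half_space[OF _ _ \<nu>])
        show "2 *\<^sub>R x - y \<in> S - ?B \<longleftrightarrow> y \<in> S - ?B" for y
        proof -
          have "dist x (2 *\<^sub>R x - y) = dist x y" unfolding dist_norm
            by (rule norm_reflection)
          then show ?thesis by (simp add: sym)
        qed
              show "S - ball x \<epsilon> \<in> sets borel" using S by (intro sets.Diff) auto
      qed
      then show ?thesis by (simp add: measure_def enn2real_mult)
    qed
    finally show ?thesis by simp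
  qed
  have "((\<lambda>\<epsilon>. LINT y : - ball x \<epsilon> | lebesgue. (indicator (- F) y - indicator F y) / norm (x - y) powr (real DIM('a) + s))
      \<longlongrightarrow> measure ?\<mu> (- S) - 2 * measure ?\<mu> (F - S)) (at_right 0)"
  proof (rule tendsto_eventually)
    have "\<forall>\<^sub>F \<epsilon> in at_right 0. \<epsilon> \<in> {0<..<\<rho>}" using \<rho>(1) by (rule eventually_at_right_real)
    then show "\<forall>\<^sub>F \<epsilon> in at_right 0. (LINT y : - ball x \<epsilon> | lebesgue. (indicator (- F) y - indicator F y) / norm (x - y) powr (real DIM('a) + s))
      = measure ?\<mu> (- S) - 2 * measure ?\<mu> (F - S)"
      by (rule eventually_mono) (rule val, simp_all)
  qed
  then show ?thesis unfolding frac_mean_curvature_def by (intro tendsto_Lim) auto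
qed

section \<open>Comparison with test sets having a flat piece of boundary\<close>

text \<open>Off the hyperplane a small ball lies entirely in \<open>F\<close> or entirely outside
  it. On the hyperplane every ball contains smaller balls on both sides.\<close>

lemma ess_boundary_flat:
  fixes \<nu> :: "'a::euclidean_space"
  assumes F: "F \<in> sets lebesgue" and \<nu>: "\<nu> \<noteq> 0"
    and FU: "F \<inter> ball x \<rho> = {y. y \<bullet> \<nu> < c} \<inter> ball x \<rho>"
  shows "ess_boundary F \<inter> ball x \<rho> = {y \<in> ball x \<rho>. y \<bullet> \<nu> = c}"
proof -
  have "y \<in> ess_boundary F \<longleftrightarrow> y \<bullet> \<nu> = c" if y: "y \<in> ball x \<rho>" for y
  proof -
    obtain r0 where r0: "0 < r0" "ball y r0 \<subseteq> ball x \<rho>"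
      using openE[OF open_ball y] by blast
    have inner_small: "\<bar>z \<bullet> \<nu> - y \<bullet> \<nu>\<bar> < e" if "z \<in> ball y (e / norm \<nu>)" for z e
    proof -
      have "\<bar>z \<bullet> \<nu> - y \<bullet> \<nu>\<bar> = \<bar>(z - y) \<bullet> \<nu>\<bar>" by (simp add: inner_diff_left)
      also have "\<dots> \<le> norm (z - y) * norm \<nu>" by (rule Cauchy_Schwarz_ineq2)
      also have "\<dots> < e" using that \<nu> by (simp add: dist_norm norm_minus_commute field_simps)
      finally show ?thesis .
    qed
    show ?thesis
    proof
      assume b: "y \<in> ess_boundary F"
      show "y \<bullet> \<nu> = c"
      proof (rule ccontr)
        assume ne: "y \<bullet> \<nu> \<noteq> c"
        define r where "r = min r0 (\<bar>y \<bullet> \<nu> - c\<bar> / norm \<nu>)"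
        have r: "0 < r" using r0 \<nu> ne by (simp add: r_def)
        have sm: "\<bar>z \<bullet> \<nu> - y \<bullet> \<nu>\<bar> < \<bar>y \<bullet> \<nu> - c\<bar>" "z \<in> ball x \<rho>" if "z \<in> ball y r" for z
          using inner_small[of z "\<bar>y \<bullet> \<nu> - c\<bar>"] r0 that by (auto simp: r_def)
        have "F \<inter> ball y r = {} \<or> F \<inter> ball y r = ball y r"
        proof (cases "y \<bullet> \<nu> < c")
          case True
          have "ball y r \<subseteq> F"
          proof
            fix z assume z: "z \<in> ball y r"
            then have "z \<bullet> \<nu> < c" using sm(1)[OF z] True by linarith
            then show "z \<in> F" using sm(2)[OF z] FU by blast
          qed
          then show ?thesis by auto
        next
          case False
          have "z \<notin> F" if z: "z \<in> ball y r" for z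
          proof -
            have "\<not> z \<bullet> \<nu> < c" using sm(1)[OF z] False by linarith
            then show ?thesis using sm(2)[OF z] FU by blast
          qed
          then show ?thesis by auto
        qed
        then show False using b r by (auto simp: ess_boundary_def)
      qed
    next
      assume eq: "y \<bullet> \<nu> = c"
      have "0 < measure lebesgue (F \<inter> ball y r) \<and> measure lebesgue (F \<inter> ball y r) < measure lebesgue (ball y r)"
        if r: "0 < r" for r
      proof -
        \<comment> \<open>The balls of radius \<open>d\<close> about \<open>y - v\<close> and
          \<open>y + v\<close> touch the hyperplane at \<open>y\<close> from its two sides. Being
          contained in the ball of radius \<open>2 * d\<close> about \<open>y\<close>, they stay in
          the region where \<open>F\<close> is flat.\<close>
        define d where "d = min r0 r / 2"
        have d: "0 < d" "2 * d \<le> r0" "2 * d \<le> r" using r r0 by (auto simp: d_def)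
        define v where "v = (d / norm \<nu>) *\<^sub>R \<nu>"
        have nv: "norm v = d" using \<nu> d by (simp add: v_def)
        have v\<nu>: "v \<bullet> \<nu> = d * norm \<nu>" using \<nu> by (simp add: v_def power2_norm_eq_inner[symmetric] power2_eq_square)
        have near: "z \<in> ball y r0" "z \<in> ball y r" if "dist w z < d" "dist y w = d" for z w
          using d that dist_triangle[of y z w] by auto
        have pull: "\<bar>(z - w) \<bullet> \<nu>\<bar> < d * norm \<nu>" if "dist w z < d" for z w
        proof -
          have "\<bar>(z - w) \<bullet> \<nu>\<bar> \<le> norm (z - w) * norm \<nu>" by (rule Cauchy_Schwarz_ineq2)
          also have "\<dots> < d * norm \<nu>" using that \<nu> by (intro mult_strict_right_mono) (auto simp: dist_norm norm_minus_commute)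
          finally show ?thesis .
        qed
        have in1: "ball (y - v) d \<subseteq> F \<inter> ball y r"
        proof
          fix z assume "z \<in> ball (y - v) d"
          then have z: "dist (y - v) z < d" by simp
          have "dist y (y - v) = d" using nv by (simp add: dist_norm)
          note n = near[OF z this]
          have "z \<bullet> \<nu> < c" using pull[OF z] v\<nu> eq by (simp add: algebra_simps)
          then show "z \<in> F \<inter> ball y r" using n r0 FU by blast
        qed
        have in2: "ball (y + v) d \<subseteq> ball y r - F"
        proof
          fix z assume "z \<in> ball (y + v) d"
          then have z: "dist (y + v) z < d" by simp
          have "dist y (y + v) = d" using nv by (simp add: dist_norm)
          note n = near[OF z this]
          have "\<not> z \<bullet> \<nu> < c" using pull[OF z] v\<nu> eq by (simp add: algebra_simps)
          then show "z \<in> ball y r - F" using n r0 FU by blast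
        qed
        have pos: "0 < measure lebesgue (ball w d)" for w :: 'a using d by (simp add: content_ball_gt_0_iff)
        have lm: "F \<inter> ball y r \<in> lmeasurable" "ball y r - F \<in> lmeasurable"
          using F lmeasurable_Int_ball[of F y r] lmeasurable_Int_ball[of "- F" y r] by (auto simp: Diff_eq Int_commute Compl_in_sets_lebesgue)
        have "measure lebesgue (ball (y - v) d) \<le> measure lebesgue (F \<inter> ball y r)"
          using in1 lm by (intro measure_mono_fmeasurable) auto
        moreover have "measure lebesgue (ball (y + v) d) \<le> measure lebesgue (ball y r - F)"
          using in2 lm by (intro measure_mono_fmeasurable) auto
        moreover have "measure lebesgue (ball y r) = measure lebesgue (F \<inter> ball y r) + measure lebesgue (ball y r - F)"
        proof -
          have "ball y r = (F \<inter> ball y r) \<union> (ball y r - F)" by auto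
          then have "measure lebesgue (ball y r) = measure lebesgue ((F \<inter> ball y r) \<union> (ball y r - F))" by simp
          also have "\<dots> = measure lebesgue (F \<inter> ball y r) + measure lebesgue (ball y r - F)"
            using lm by (intro measure_Un_AE) (auto simp: fmeasurable_def)
          finally show ?thesis .
        qed
        ultimately show ?thesis using pos[of "y - v"] pos[of "y + v"] by linarith
      qed
      then show "y \<in> ess_boundary F" by (simp add: ess_boundary_def)
    qed
  qed
  then show ?thesis by auto
qed

lemma C2_hypersurface_near_flat:
  fixes \<nu> :: "'a::euclidean_space"
  assumes "0 < \<rho>" and \<nu>: "\<nu> \<noteq> 0" and B: "B \<inter> ball x \<rho> = {y \<in> ball x \<rho>. y \<bullet> \<nu> = c}"
  shows "C2_hypersurface_near B x"
  unfolding C2_hypersurface_near_def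
proof (intro exI[of _ "ball x \<rho>"] exI[of _ "\<lambda>y. y \<bullet> \<nu> - c"] conjI ballI)
  let ?L = "blinfun_inner_left \<nu>"
  have der: "((\<lambda>y. y \<bullet> \<nu> - c) has_derivative (\<lambda>h. h \<bullet> \<nu>)) (at y)" for y
    by (auto intro!: derivative_eq_intros)
  show "C2_on (\<lambda>y. y \<bullet> \<nu> - c) (ball x \<rho>)"
    unfolding C2_on_def
    using der by (intro exI[of _ "\<lambda>_. ?L"] exI[of _ "\<lambda>_. 0"]) (auto simp: blinfun_inner_left.rep_eq zero_blinfun.rep_eq)
  show "\<not> ((\<lambda>y. y \<bullet> \<nu> - c) has_derivative (\<lambda>_. 0)) (at y)" for y
  proof
    assume "((\<lambda>y. y \<bullet> \<nu> - c) has_derivative (\<lambda>_. 0)) (at y)"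
    then have "(\<lambda>h. h \<bullet> \<nu>) = (\<lambda>_. 0)" using der has_derivative_unique by blast
    then have "\<nu> \<bullet> \<nu> = 0" by metis
    then show False using \<nu> by simp
  qed
qed (use assms in auto)

text \<open>
  Any half-space with \<open>x\<close> on its boundary has curvature \<open>0\<close> outside the symmetric set \<open>S\<close>, so it may
  serve as the reference with which \<open>F\<close> is compared, whatever the tangent direction \<open>\<nu>\<close>.
\<close>

lemma visc_comparison:
  fixes x \<nu> \<nu>' :: "'a::euclidean_space"
  assumes E: "E \<in> sets lebesgue" and visc: "visc_frac_curv_nonpos s E" and x: "x \<in> ess_supp E"
    and s: "0 < s" and \<rho>: "0 < \<rho>" "ball x \<rho> \<subseteq> S" and S: "S \<in> sets borel"
    and sym: "\<And>y. 2 *\<^sub>R x - y \<in> S \<longleftrightarrow> y \<in> S" and \<nu>: "\<nu> \<noteq> 0" and \<nu>': "\<nu>' \<noteq> 0"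
    and F: "F \<in> sets lebesgue" "ess_subset E F" and FS: "F \<inter> S = {y. y \<bullet> \<nu> < x \<bullet> \<nu>} \<inter> S"
  shows "emeasure (kernel_measure s x) ({y. y \<bullet> \<nu>' < x \<bullet> \<nu>'} - F - S)
      \<le> emeasure (kernel_measure s x) (F - {y. y \<bullet> \<nu>' < x \<bullet> \<nu>'} - S)"
proof -
  let ?\<mu> = "kernel_measure s x"
  define T where "T = {y. y \<bullet> \<nu>' < x \<bullet> \<nu>'}"
  have T: "T \<in> sets lebesgue" unfolding T_def by (auto intro!: borel_open open_Collect_less continuous_intros)
  have Sl: "S \<in> sets lebesgue" using S by auto
  have FB: "F \<inter> ball x \<rho> = {y. y \<bullet> \<nu> < x \<bullet> \<nu>} \<inter> ball x \<rho>" using FS \<rho> by auto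
  note bd = ess_boundary_flat[OF F(1) \<nu> FB]
  have xF: "x \<in> ess_boundary F" using bd \<rho> by auto
  have C2: "C2_hypersurface_near (ess_boundary F) x" by (rule C2_hypersurface_near_flat[OF \<rho>(1) \<nu> bd])
  \<comment> \<open>Up to a null set \<open>E\<close> lies in \<open>F\<close>, and \<open>F\<close>
    already misses a positive part of every ball around \<open>x\<close>.\<close>
  have xE: "x \<in> ess_boundary E"
    unfolding ess_boundary_def
  proof (intro CollectI allI impI conjI)
    fix r :: real assume r: "0 < r"
    then show "0 < measure lebesgue (E \<inter> ball x r)" using x by (simp add: ess_supp_def)
    have "measure lebesgue (E \<inter> ball x r) \<le> measure lebesgue ((F \<inter> ball x r) \<union> (E - F))"
    proof (rule measure_mono_fmeasurable)
      show "F \<inter> ball x r \<union> (E - F) \<in> lmeasurable"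
        using F(2) unfolding ess_subset_def by (intro fmeasurable.Un lmeasurable_Int_ball[OF F(1)]) (rule fmeasurableI_null_sets)
    qed (use lmeasurable_Int_ball[OF E, of x r] in auto)
    also have "\<dots> = measure lebesgue (F \<inter> ball x r)"
      using F lmeasurable_Int_ball[of F x r] unfolding ess_subset_def by (intro measure_Un_null_set) auto
    also have "\<dots> < measure lebesgue (ball x r)" using xF r by (auto simp: ess_boundary_def)
    finally show "measure lebesgue (E \<inter> ball x r) < measure lebesgue (ball x r)" .
  qed
  have "frac_mean_curvature s F x \<le> 0"
    using visc xE F xF C2 unfolding visc_frac_curv_nonpos_def visc_frac_curv_nonpos_at_def by blast
  then have le: "measure ?\<mu> (- S) \<le> 2 * measure ?\<mu> (F - S)"
    by (simp add: frac_mean_curvature_flat[OF s \<rho> S sym \<nu> F(1) FS])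
  \<comment> \<open>Half of the mass outside \<open>S\<close> belongs to the reference half-space
    \<open>T\<close>. The curvature inequality thus compares \<open>T - S\<close> with
    \<open>F - S\<close>, and their common part, of finite mass, is cancelled below.\<close>
  have "emeasure ?\<mu> (- S) = 2 * emeasure ?\<mu> (- S \<inter> T)"
    unfolding T_def by (rule kernel_measure_half_space[OF _ _ \<nu>']) (use S sym in auto)
  then have half: "measure ?\<mu> (- S) = 2 * measure ?\<mu> (- S \<inter> T)" by (simp add: measure_def enn2real_mult)
  have fin: "emeasure ?\<mu> A \<noteq> \<infinity>" if "A \<in> sets lebesgue" "A \<inter> S = {}" for A
    using kernel_measure_finite[OF s \<rho>(1) that(1)] that(2) \<rho>(2) by (auto simp: less_top[symmetric])
  have m: "T - F - S \<in> sets lebesgue" "T \<inter> F - S \<in> sets lebesgue" "F - T - S \<in> sets lebesgue"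
    by (intro sets.Diff sets.Int T F(1) Sl)+
  have finm: "emeasure ?\<mu> (T - F - S) \<noteq> \<infinity>" "emeasure ?\<mu> (T \<inter> F - S) \<noteq> \<infinity>" "emeasure ?\<mu> (F - T - S) \<noteq> \<infinity>"
    by (rule fin[OF m(1)], blast, rule fin[OF m(2)], blast, rule fin[OF m(3)], blast)
  have "measure ?\<mu> (- S \<inter> T) = measure ?\<mu> (T - F - S) + measure ?\<mu> (T \<inter> F - S)"
  proof -
    have eq: "- S \<inter> T = (T - F - S) \<union> (T \<inter> F - S)" by auto
    have un: "measure ?\<mu> ((T - F - S) \<union> (T \<inter> F - S)) = measure ?\<mu> (T - F - S) + measure ?\<mu> (T \<inter> F - S)"
    proof (rule measure_Union)
      show "emeasure ?\<mu> (T - F - S) \<noteq> \<infinity>" "emeasure ?\<mu> (T \<inter> F - S) \<noteq> \<infinity>"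
        by (rule finm)+
      show "T - F - S \<in> sets ?\<mu>" "T \<inter> F - S \<in> sets ?\<mu>" using m by simp_all
    qed auto
    show ?thesis by (rule trans[OF arg_cong[where f="measure ?\<mu>", OF eq] un])
  qed
  moreover have "measure ?\<mu> (F - S) = measure ?\<mu> (F - T - S) + measure ?\<mu> (T \<inter> F - S)"
  proof -
    have eq: "F - S = (F - T - S) \<union> (T \<inter> F - S)" by auto
    have un: "measure ?\<mu> ((F - T - S) \<union> (T \<inter> F - S)) = measure ?\<mu> (F - T - S) + measure ?\<mu> (T \<inter> F - S)"
    proof (rule measure_Union)
      show "emeasure ?\<mu> (F - T - S) \<noteq> \<infinity>" "emeasure ?\<mu> (T \<inter> F - S) \<noteq> \<infinity>"
        by (rule finm)+
      show "F - T - S \<in> sets ?\<mu>" "T \<inter> F - S \<in> sets ?\<mu>" using m by simp_all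
    qed auto
    show ?thesis by (rule trans[OF arg_cong[where f="measure ?\<mu>", OF eq] un])
  qed
  ultimately have "measure ?\<mu> (T - F - S) \<le> measure ?\<mu> (F - T - S)" using le half by linarith
  then show ?thesis
    using finm unfolding T_def[symmetric] by (simp add: emeasure_eq_ennreal_measure ennreal_leI)
qed

section \<open>The planar barrier\<close>

lemma frame_expansion:
  fixes e \<omega> y :: "real^2"
  assumes "norm e = 1" "norm \<omega> = 1" "e \<bullet> \<omega> = 0"
  shows "y = (y \<bullet> e) *\<^sub>R e + (y \<bullet> \<omega>) *\<^sub>R \<omega>"
proof -
  define z where "z = y - ((y \<bullet> e) *\<^sub>R e + (y \<bullet> \<omega>) *\<^sub>R \<omega>)"
  have z: "e$1 * z$1 + e$2 * z$2 = 0" "\<omega>$1 * z$1 + \<omega>$2 * z$2 = 0"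
  proof -
    have "e \<bullet> e = 1" "\<omega> \<bullet> \<omega> = 1" "\<omega> \<bullet> e = 0" using assms by (auto simp: norm_eq_1 inner_commute)
    then have "e \<bullet> z = 0" "\<omega> \<bullet> z = 0" using assms(3)
      by (auto simp: z_def inner_diff_right inner_add_right inner_commute)
    then show "e$1 * z$1 + e$2 * z$2 = 0" "\<omega>$1 * z$1 + \<omega>$2 * z$2 = 0" by (auto simp: inner_vec_def sum_2)
  qed
  have ew: "e$1 * e$1 + e$2 * e$2 = 1" "\<omega>$1 * \<omega>$1 + \<omega>$2 * \<omega>$2 = 1" "e$1 * \<omega>$1 + e$2 * \<omega>$2 = 0"
    using assms by (auto simp: norm_eq_1 inner_vec_def sum_2)
  \<comment> \<open>The determinant of the frame, with square 1 by Lagrange's identity. Cramer's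
    rule then shows that the residual \<open>z\<close>, orthogonal to both vectors, is zero.\<close>
  define D where "D = e$1 * \<omega>$2 - e$2 * \<omega>$1"
  have "D * D = (e$1 * e$1 + e$2 * e$2) * (\<omega>$1 * \<omega>$1 + \<omega>$2 * \<omega>$2) - (e$1 * \<omega>$1 + e$2 * \<omega>$2)\<^sup>2"
    by (simp add: D_def power2_eq_square algebra_simps)
  then have "D \<noteq> 0" unfolding ew by auto
  moreover have "D * z$1 = \<omega>$2 * (e$1 * z$1 + e$2 * z$2) - e$2 * (\<omega>$1 * z$1 + \<omega>$2 * z$2)"
    "D * z$2 = e$1 * (\<omega>$1 * z$1 + \<omega>$2 * z$2) - \<omega>$1 * (e$1 * z$1 + e$2 * z$2)"
    by (simp_all add: D_def algebra_simps)
  ultimately have "z = 0" unfolding z by (simp add: vec_eq_iff forall_2)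
  then show ?thesis by (simp add: z_def)
qed

text \<open>Over each \<open>p\<close> outside the strip both sets are vertical segments between the
  barrier and the height of \<open>x\<close>, with length \<open>t\<close> times the weight in
  \<open>mass_above\<close> or \<open>mass_below\<close>. On the upper segments the kernel is at
  most its value at the horizontal distance, on the lower ones at least \<open>\<theta>\<close>
  times that value, so the one-dimensional gap decides.\<close>

lemma barrier_mass:
  fixes e \<omega> x :: "real^2"
  assumes on: "norm e = 1" "norm \<omega> = 1" "e \<bullet> \<omega> = 0"
    and b: "0 < b" "b < 1/2" and r: "0 < r" and t: "0 < t" and \<theta>: "0 < \<theta>"
    and \<theta>t: "\<theta> \<le> sqrt (1 + (t / r)\<^sup>2) powr (-(2+2*b))"
    and X: "1 \<le> x \<bullet> e"
    and gap: "\<And>X. 0 < X \<Longrightarrow> mass_above b r X < ennreal \<theta> * mass_below b r X"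
  defines "G \<equiv> {y. y \<bullet> \<omega> \<le> x \<bullet> \<omega> + t * (\<bar>y \<bullet> e\<bar> powr b - (x \<bullet> e) powr b)}"
    and "H \<equiv> {y. y \<bullet> \<omega> < x \<bullet> \<omega>}"
    and "S \<equiv> {y. \<bar>y \<bullet> e - x \<bullet> e\<bar> < r * (x \<bullet> e)}"
  shows "emeasure (kernel_measure (2*b) x) (G - H - S) < emeasure (kernel_measure (2*b) x) (H - G - S)"
proof -
  define X where "X = x \<bullet> e"
  define h where "h = x \<bullet> \<omega>"
  define c where "c = -(2 + 2*b)"
  have X1: "1 \<le> X" "0 < X" using X by (auto simp: X_def)
  have rX: "0 < r * X" using r X1 by simp
  let ?K = "\<lambda>y. ennreal (norm (x - y) powr c)"
  let ?\<psi> = "\<lambda>p q. p *\<^sub>R e + q *\<^sub>R \<omega>"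
  have ee: "e \<bullet> e = 1" "\<omega> \<bullet> \<omega> = 1" "\<omega> \<bullet> e = 0" using on by (auto simp: norm_eq_1 inner_commute)
  have co[simp]: "?\<psi> p q \<bullet> e = p" "?\<psi> p q \<bullet> \<omega> = q" for p q
    using ee on by (auto simp: inner_add_left)
  have Gm[measurable]: "G \<in> sets borel" unfolding G_def
    using b by (intro borel_closed closed_Collect_le continuous_intros continuous_on_powr') auto
  have Hm[measurable]: "H \<in> sets borel" unfolding H_def
    by (intro borel_open open_Collect_less continuous_intros)
  have Sm[measurable]: "S \<in> sets borel" unfolding S_def
    by (intro borel_open open_Collect_less continuous_intros)
  have em: "emeasure (kernel_measure (2*b) x) A = (\<integral>\<^sup>+p. \<integral>\<^sup>+q. ?K (?\<psi> p q) * indicator A (?\<psi> p q) \<partial>lborel \<partial>lborel)"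
    if [measurable]: "A \<in> sets borel" for A
    by (subst emeasure_kernel_measure) (auto simp: c_def intro!: nn_integral_orthonormal_frame on)
  have lo: "\<bar>p - X\<bar> \<le> norm (x - ?\<psi> p q)" for p q
  proof -
    have "\<bar>(x - ?\<psi> p q) \<bullet> e\<bar> \<le> norm (x - ?\<psi> p q) * norm e" by (rule Cauchy_Schwarz_ineq2)
    then show ?thesis using on by (simp add: inner_diff_left X_def[symmetric] abs_minus_commute del: inner_add_left)
  qed

  have GHS: "?\<psi> p q \<in> G - H - S \<longleftrightarrow> h \<le> q \<and> q \<le> h + t * (\<bar>p\<bar> powr b - X powr b) \<and> r * X \<le> \<bar>p - X\<bar>" for p q
    unfolding G_def H_def S_def Diff_iff mem_Collect_eq co by (auto simp: X_def h_def)
  have HGS: "?\<psi> p q \<in> H - G - S \<longleftrightarrow> h + t * (\<bar>p\<bar> powr b - X powr b) < q \<and> q < h \<and> r * X \<le> \<bar>p - X\<bar>" for p q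
    unfolding G_def H_def S_def Diff_iff mem_Collect_eq co by (auto simp: X_def h_def)
  let ?W = "{p. r * X \<le> \<bar>p - X\<bar>}"
  have c0: "c \<le> 0" using b by (simp add: c_def)
  \<comment> \<open>The horizontal distance is at most the true one, and the kernel decreases with
    distance.\<close>
  have up: "(\<integral>\<^sup>+q. ?K (?\<psi> p q) * indicator (G - H - S) (?\<psi> p q) \<partial>lborel)
      \<le> ennreal t * (ennreal (max 0 (\<bar>p\<bar> powr b - X powr b) * \<bar>p - X\<bar> powr c) * indicator ?W p)" for p
  proof -
    define d where "d = t * max 0 (\<bar>p\<bar> powr b - X powr b)"
    have d: "0 \<le> d" "t * (\<bar>p\<bar> powr b - X powr b) \<le> d" using t by (auto simp: d_def intro: mult_left_mono)
    have "(\<integral>\<^sup>+q. ?K (?\<psi> p q) * indicator (G - H - S) (?\<psi> p q) \<partial>lborel)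
      \<le> (\<integral>\<^sup>+q. (ennreal (\<bar>p - X\<bar> powr c) * indicator ?W p) * indicator {h..h+d} q \<partial>lborel)"
    proof (intro nn_integral_mono)
      fix q
      show "?K (?\<psi> p q) * indicator (G - H - S) (?\<psi> p q)
        \<le> (ennreal (\<bar>p - X\<bar> powr c) * indicator ?W p) * indicator {h..h+d} q"
      proof (cases "?\<psi> p q \<in> G - H - S")
        case True
        note * = True[unfolded GHS]
        have "norm (x - ?\<psi> p q) powr c \<le> \<bar>p - X\<bar> powr c"
          using * rX lo c0 by (intro powr_mono2') auto
        moreover have "q \<in> {h..h+d}" "p \<in> ?W" using * d(2) by auto
        ultimately show ?thesis using True by (simp add: ennreal_leI)
      qed simp
    qed
    also have "\<dots> = (ennreal (\<bar>p - X\<bar> powr c) * indicator ?W p) * ennreal d"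
      using d by (subst nn_integral_cmult_indicator) auto
    also have "\<dots> = ennreal t * (ennreal (max 0 (\<bar>p\<bar> powr b - X powr b) * \<bar>p - X\<bar> powr c) * indicator ?W p)"
      using t by (simp add: d_def ennreal_mult' mult_ac)
    finally show ?thesis .
  qed
  have down: "ennreal (t * \<theta>) * (ennreal (max 0 (X powr b - \<bar>p\<bar> powr b) * \<bar>p - X\<bar> powr c) * indicator ?W p)
    \<le> (\<integral>\<^sup>+q. ?K (?\<psi> p q) * indicator (H - G - S) (?\<psi> p q) \<partial>lborel)" for p
  proof -
    define d where "d = t * max 0 (X powr b - \<bar>p\<bar> powr b)"
    have d: "0 \<le> d" using t by (auto simp: d_def)
    have "ennreal (t * \<theta>) * (ennreal (max 0 (X powr b - \<bar>p\<bar> powr b) * \<bar>p - X\<bar> powr c) * indicator ?W p)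
      = (ennreal (\<theta> * \<bar>p - X\<bar> powr c) * indicator ?W p) * ennreal d"
      using t \<theta> by (simp add: d_def ennreal_mult' mult_ac)
    also have "\<dots> = (\<integral>\<^sup>+q. (ennreal (\<theta> * \<bar>p - X\<bar> powr c) * indicator ?W p) * indicator {h-d<..<h} q \<partial>lborel)"
      using d by (subst nn_integral_cmult_indicator) auto
    also have "\<dots> \<le> (\<integral>\<^sup>+q. ?K (?\<psi> p q) * indicator (H - G - S) (?\<psi> p q) \<partial>lborel)"
    proof (intro nn_integral_mono)
      fix q
      show "(ennreal (\<theta> * \<bar>p - X\<bar> powr c) * indicator ?W p) * indicator {h-d<..<h} q
        \<le> ?K (?\<psi> p q) * indicator (H - G - S) (?\<psi> p q)"
      proof (cases "p \<in> ?W \<and> q \<in> {h-d<..<h}")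
        case True
        then have pq: "r * X \<le> \<bar>p - X\<bar>" "h - d < q" "q < h" by auto
        have pX: "0 < \<bar>p - X\<bar>" using pq(1) rX by linarith
        have "0 < d" using pq by linarith
        then have d': "d = t * (X powr b - \<bar>p\<bar> powr b)" using t by (auto simp: d_def max_def split: if_splits)
        have inA: "?\<psi> p q \<in> H - G - S" unfolding HGS using pq d' by (simp add: algebra_simps)
        \<comment> \<open>Here \<open>1 \<le> X\<close> enters: the drop of the barrier below its
          contact value is at most \<open>t * X\<close>, hence at most \<open>t / r\<close> times
          the horizontal distance outside the strip. This bounds the true distance by
          \<open>sqrt (1 + (t/r)\<^sup>2)\<close> times the horizontal one.\<close>
        have "X powr b \<le> X powr 1" using X1 b by (intro powr_mono) auto
        then have "t * (X powr b - \<bar>p\<bar> powr b) \<le> t * X" using t X1 by (intro mult_left_mono) (auto intro: order_trans[of _ "X powr b"])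
        also have "\<dots> = t / r * (r * X)" using r by simp
        also have "\<dots> \<le> t / r * \<bar>p - X\<bar>" using t r pq(1) by (intro mult_left_mono) auto
        finally have Q: "\<bar>q - h\<bar> \<le> t / r * \<bar>p - X\<bar>" using d' pq by linarith
        have "norm (x - ?\<psi> p q) \<le> sqrt (1 + (t/r)\<^sup>2) * \<bar>p - X\<bar>"
        proof -
          have x: "x = ?\<psi> X h" 
            using frame_expansion[OF on, of x] by (simp add: X_def h_def)
          have "x - ?\<psi> p q = (X - p) *\<^sub>R e + (h - q) *\<^sub>R \<omega>" by (subst x) (simp add: algebra_simps)
          then have "(norm (x - ?\<psi> p q))\<^sup>2 = ((X - p) *\<^sub>R e + (h - q) *\<^sub>R \<omega>) \<bullet> ((X - p) *\<^sub>R e + (h - q) *\<^sub>R \<omega>)"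
            by (simp only: power2_norm_eq_inner)
          also have "\<dots> = (X - p)\<^sup>2 + (h - q)\<^sup>2"
            using ee on(3) by (simp add: inner_add_left inner_add_right power2_eq_square)
          also have "\<dots> \<le> (X - p)\<^sup>2 + (t / r * \<bar>p - X\<bar>)\<^sup>2"
            using Q by (intro add_left_mono power2_le_iff_abs_le[THEN iffD2]) (auto simp: abs_minus_commute)
          also have "\<dots> = (1 + (t/r)\<^sup>2) * \<bar>p - X\<bar>\<^sup>2"
            unfolding power_mult_distrib power2_abs power2_commute[of X p] by (simp add: distrib_right)
          finally have "norm (x - ?\<psi> p q) \<le> sqrt ((1 + (t/r)\<^sup>2) * \<bar>p - X\<bar>\<^sup>2)" by (rule real_le_rsqrt)
          then show ?thesis by (simp add: real_sqrt_mult)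
        qed
        moreover have "0 < norm (x - ?\<psi> p q)" using lo[of p q] pX by linarith
        ultimately have "(sqrt (1 + (t/r)\<^sup>2) * \<bar>p - X\<bar>) powr c \<le> norm (x - ?\<psi> p q) powr c"
          using c0 by (intro powr_mono2') auto
        moreover have "\<theta> * \<bar>p - X\<bar> powr c \<le> (sqrt (1 + (t/r)\<^sup>2) * \<bar>p - X\<bar>) powr c"
          using \<theta>t unfolding powr_mult c_def[symmetric] by (intro mult_right_mono) auto
        ultimately show ?thesis using True inA by (simp add: ennreal_leI)
      qed auto
    qed
    finally show ?thesis .
  qed
  have "emeasure (kernel_measure (2*b) x) (G - H - S)
      \<le> (\<integral>\<^sup>+p. ennreal t * (ennreal (max 0 (\<bar>p\<bar> powr b - X powr b) * \<bar>p - X\<bar> powr c) * indicator ?W p) \<partial>lborel)"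
    using up by (subst em) (auto intro!: nn_integral_mono)
  also have "\<dots> = ennreal t * (\<integral>\<^sup>+p. ennreal (max 0 (\<bar>p\<bar> powr b - X powr b) * \<bar>p - X\<bar> powr c) * indicator ?W p \<partial>lborel)"
    by (rule nn_integral_cmult) measurable
  also have "\<dots> < ennreal t * (ennreal \<theta> * (\<integral>\<^sup>+p. ennreal (max 0 (X powr b - \<bar>p\<bar> powr b) * \<bar>p - X\<bar> powr c) * indicator ?W p \<partial>lborel))"
    using gap[unfolded mass_above_def mass_below_def, OF X1(2)] t unfolding c_def by (intro ennreal_mult_strict_left_mono) auto
  also have "\<dots> = ennreal (t * \<theta>) * (\<integral>\<^sup>+p. ennreal (max 0 (X powr b - \<bar>p\<bar> powr b) * \<bar>p - X\<bar> powr c) * indicator ?W p \<partial>lborel)"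
    using t \<theta> by (simp add: ennreal_mult' mult_ac)
  also have "\<dots> = (\<integral>\<^sup>+p. ennreal (t * \<theta>) * (ennreal (max 0 (X powr b - \<bar>p\<bar> powr b) * \<bar>p - X\<bar> powr c) * indicator ?W p) \<partial>lborel)"
    by (rule nn_integral_cmult[symmetric]) measurable
  also have "\<dots> \<le> emeasure (kernel_measure (2*b) x) (H - G - S)"
    using down by (subst em) (auto intro!: nn_integral_mono)
  finally show ?thesis .
qed

text \<open>The test set is the half-plane under the tangent line inside the strip \<open>S\<close>
  and the region under the barrier outside it. Comparison with the horizontal half-plane
  \<open>H\<close> yields the inequality opposite to \<open>barrier_mass\<close>.\<close>

lemma no_touching:
  fixes e \<omega> x :: "real^2"
  assumes E: "E \<in> sets lebesgue" and visc: "visc_frac_curv_nonpos (2*b) E" and x: "x \<in> ess_supp E"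
    and on: "norm e = 1" "norm \<omega> = 1" "e \<bullet> \<omega> = 0"
    and b: "0 < b" "b < 1/2" and r: "0 < r" "r < 1" and t: "0 < t" and \<theta>: "0 < \<theta>"
    and \<theta>t: "\<theta> \<le> sqrt (1 + (t / r)\<^sup>2) powr (-(2+2*b))"
    and X: "1 \<le> x \<bullet> e"
    and gap: "\<And>X. 0 < X \<Longrightarrow> mass_above b r X < ennreal \<theta> * mass_below b r X"
    and below: "\<And>y. y \<in> ess_supp E \<Longrightarrow> y \<bullet> \<omega> \<le> x \<bullet> \<omega> + t * (\<bar>y \<bullet> e\<bar> powr b - (x \<bullet> e) powr b)"
  shows False
proof -
  define X where "X = x \<bullet> e"
  define G where "G = {y. y \<bullet> \<omega> \<le> x \<bullet> \<omega> + t * (\<bar>y \<bullet> e\<bar> powr b - (x \<bullet> e) powr b)}"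
  define H where "H = {y. y \<bullet> \<omega> < x \<bullet> \<omega>}"
  define S where "S = {y. \<bar>y \<bullet> e - x \<bullet> e\<bar> < r * (x \<bullet> e)}"
  have X1: "1 \<le> X" "0 < X" using X by (auto simp: X_def)
  have Gm: "G \<in> sets borel" unfolding G_def
    using b by (intro borel_closed closed_Collect_le continuous_intros continuous_on_powr') auto
  have Sm: "S \<in> sets borel" unfolding S_def
    by (intro borel_open open_Collect_less continuous_intros)
  \<comment> \<open>The slope of the barrier at the contact point; \<open>\<nu>\<close> is then
    normal to the tangent line.\<close>
  define m where "m = t * (b * X powr (b - 1))"
  define \<nu> where "\<nu> = \<omega> - m *\<^sub>R e"
  have "\<nu> \<bullet> \<omega> = 1" using on by (simp add: \<nu>_def inner_diff_left norm_eq_1)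
  then have \<nu>: "\<nu> \<noteq> 0" by auto
  define T where "T = {y. y \<bullet> \<nu> < x \<bullet> \<nu>}"
  have Tm: "T \<in> sets borel" unfolding T_def
    by (intro borel_open open_Collect_less continuous_intros)
  define F where "F = (T \<inter> S) \<union> (G - S)"
  have Fm: "F \<in> sets lebesgue" using Tm Sm Gm by (auto simp: F_def)
  have tangent: "y \<bullet> \<nu> \<le> x \<bullet> \<nu>" if y: "y \<in> ess_supp E" "y \<in> S" for y
  proof -
    define p where "p = y \<bullet> e"
    have "\<bar>p - X\<bar> < r * X" using y by (simp add: S_def p_def X_def)
    moreover have "r * X < 1 * X" using r X1 by (intro mult_strict_right_mono) auto
    ultimately have p: "0 < p" by linarith
    \<comment> \<open>Weighted arithmetic-geometric means express that the concave power lies below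
      its tangent at \<open>X\<close>. The strip has half-width less than \<open>X\<close>, which
      keeps \<open>p\<close> positive.\<close>
    have "p powr b * X powr (1 - b) \<le> b * p + (1 - b) * X"
      using b p X1 by (intro Youngs_inequality_0) auto
    then have "p powr b * X powr (1 - b) * X powr (b - 1) \<le> (b * p + (1 - b) * X) * X powr (b - 1)"
      by (rule mult_right_mono) simp
    moreover have "X powr (1 - b) * X powr (b - 1) = 1" using X1 by (simp flip: powr_add)
    moreover have "X * X powr (b - 1) = X powr b" using X1 by (simp add: powr_diff)
    ultimately have "p powr b \<le> X powr b + b * X powr (b - 1) * (p - X)"
      by (simp add: algebra_simps mult.assoc) (metis mult.commute mult.left_commute)
    then have "t * (p powr b - X powr b) \<le> t * (b * X powr (b - 1) * (p - X))"
      using t by (intro mult_left_mono) auto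
    then have "y \<bullet> \<omega> \<le> x \<bullet> \<omega> + m * (p - X)"
      using below[OF y(1)] p by (simp add: p_def[symmetric] X_def[symmetric] m_def algebra_simps)
    then show ?thesis by (simp add: \<nu>_def inner_diff_right p_def X_def algebra_simps)
  qed
  have EF: "ess_subset E F"
  proof -
    \<comment> \<open>Since \<open>T\<close> is open, \<open>F\<close> may miss points of
      \<open>E\<close> on the tangent line, but that line is null.\<close>
    have "E - F \<subseteq> (E - ess_supp E) \<union> {y. \<nu> \<bullet> y = x \<bullet> \<nu>}"
    proof
      fix y assume y: "y \<in> E - F"
      show "y \<in> (E - ess_supp E) \<union> {y. \<nu> \<bullet> y = x \<bullet> \<nu>}"
      proof (cases "y \<in> ess_supp E \<and> y \<in> S")
        case True
        then have "y \<bullet> \<nu> = x \<bullet> \<nu>" using tangent[of y] y by (force simp: F_def T_def)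
        then show ?thesis by (simp add: inner_commute)
      next
        case False
        then show ?thesis using y below by (auto simp: F_def G_def)
      qed
    qed
    moreover have "{y. \<nu> \<bullet> y = x \<bullet> \<nu>} \<in> null_sets lebesgue"
      using negligible_hyperplane[of \<nu> "x \<bullet> \<nu>"] \<nu> by (simp add: negligible_iff_null_sets)
    ultimately show ?thesis
      using ess_subset_ess_supp[OF E] unfolding ess_subset_def by (metis null_sets.Un null_sets_lebesgue_subset)
  qed
  have BS: "ball x (r * X) \<subseteq> S"
  proof
    fix y assume y: "y \<in> ball x (r * X)"
    have "\<bar>(y - x) \<bullet> e\<bar> \<le> norm (y - x) * norm e" by (rule Cauchy_Schwarz_ineq2)
    then show "y \<in> S" using y on by (simp add: S_def X_def inner_diff_left dist_norm norm_minus_commute)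
  qed
  \<comment> \<open>The reference normal is \<open>\<omega>\<close> although the flat piece of
    \<open>F\<close> has normal \<open>\<nu>\<close>, so the tangent slope drops out of the
    estimate.\<close>
  have "emeasure (kernel_measure (2*b) x) (H - F - S) \<le> emeasure (kernel_measure (2*b) x) (F - H - S)"
    unfolding H_def
  proof (rule visc_comparison[OF E visc x _ _ BS Sm _ \<nu> _ Fm EF])
    show "\<omega> \<noteq> 0" using on by auto
    show "2 *\<^sub>R x - y \<in> S \<longleftrightarrow> y \<in> S" for y
      by (simp add: S_def inner_diff_left) linarith
    show "F \<inter> S = {y. y \<bullet> \<nu> < x \<bullet> \<nu>} \<inter> S" by (auto simp: F_def T_def)
  qed (use b r X1 in auto)
  moreover have "H - F - S = H - G - S" "F - H - S = G - H - S" by (auto simp: F_def)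
  ultimately have "emeasure (kernel_measure (2*b) x) (H - G - S) \<le> emeasure (kernel_measure (2*b) x) (G - H - S)" by simp
  moreover have "emeasure (kernel_measure (2*b) x) (G - H - S) < emeasure (kernel_measure (2*b) x) (H - G - S)"
    unfolding G_def H_def S_def by (rule barrier_mass[OF on b r(1) t \<theta> \<theta>t X gap])
  ultimately show False by simp
qed

section \<open>The half-plane theorem\<close>

text \<open>The density vanishes only at \<open>x\<close>, where \<open>0 powr\<close> any exponent
  is 0; hence \<open>x\<close> is kept out of \<open>A\<close>.\<close>

lemma null_sets_kernel_measure:
  assumes A: "A \<in> sets lebesgue" "x \<notin> A" and z: "emeasure (kernel_measure s x) A = 0"
  shows "A \<in> null_sets lebesgue"
proof -
  have "A \<in> null_sets (kernel_measure s x)" using A z by (intro null_setsI) auto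
  then have "AE y in lebesgue. y \<in> A \<longrightarrow> ennreal (norm (x - y) powr (-(real DIM('a) + s))) = 0"
    unfolding kernel_measure_def by (subst (asm) null_sets_density_iff) auto
  then have "AE y in lebesgue. y \<notin> A"
    by (rule eventually_mono) (use A in auto)
  then show ?thesis using A AE_iff_null_sets by blast
qed

text \<open>The test sets stay inside \<open>P\<close>, so the right-hand side of
  \<open>visc_comparison\<close> is zero and nothing of \<open>P\<close> outside a small ball can be
  missing from \<open>E\<close>.\<close>

lemma half_plane_if_touching:
  fixes \<omega> x :: "'a::euclidean_space"
  assumes E: "E \<in> sets lebesgue" and visc: "visc_frac_curv_nonpos s E" and s: "0 < s"
    and x: "x \<in> ess_supp E" and \<omega>: "\<omega> \<noteq> 0"
    and below: "\<And>y. y \<in> ess_supp E \<Longrightarrow> y \<bullet> \<omega> \<le> x \<bullet> \<omega>"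
  shows "ess_equal E {y. y \<bullet> \<omega> < x \<bullet> \<omega>}"
proof -
  define P where "P = {y. y \<bullet> \<omega> < x \<bullet> \<omega>}"
  have Pb: "P \<in> sets borel" unfolding P_def by (intro borel_open open_Collect_less continuous_intros)
  then have P: "P \<in> sets lebesgue" by auto
  have "E - P \<subseteq> (E - ess_supp E) \<union> {y. \<omega> \<bullet> y = x \<bullet> \<omega>}"
    using below by (force simp: P_def inner_commute)
  moreover have "{y. \<omega> \<bullet> y = x \<bullet> \<omega>} \<in> null_sets lebesgue"
    using negligible_hyperplane[of \<omega> "x \<bullet> \<omega>"] \<omega> by (simp add: negligible_iff_null_sets)
  ultimately have EP: "E - P \<in> null_sets lebesgue"
    using ess_subset_ess_supp[OF E] unfolding ess_subset_def by (metis null_sets.Un null_sets_lebesgue_subset)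
  have null: "P - E - ball x \<rho> \<in> null_sets lebesgue" if \<rho>: "0 < \<rho>" for \<rho>
  proof -
    \<comment> \<open>Flat near \<open>x\<close>, equal to \<open>E\<close> elsewhere up to a null
      set, and contained in \<open>P\<close>.\<close>
    define F where "F = P \<inter> (E \<union> ball x \<rho>)"
    have Fm: "F \<in> sets lebesgue" unfolding F_def using P E by (intro sets.Int sets.Un) auto
    have "E - F \<subseteq> E - P" by (auto simp: F_def)
    then have EF: "ess_subset E F" unfolding ess_subset_def using EP null_sets_lebesgue_subset by blast
    have "emeasure (kernel_measure s x) (P - F - ball x \<rho>) \<le> emeasure (kernel_measure s x) (F - P - ball x \<rho>)"
      unfolding P_def
    proof (rule visc_comparison[OF E visc x s \<rho> subset_refl _ _ \<omega> \<omega> Fm EF])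
      show "2 *\<^sub>R x - y \<in> ball x \<rho> \<longleftrightarrow> y \<in> ball x \<rho>" for y
        by (simp add: dist_norm norm_reflection)
      show "F \<inter> ball x \<rho> = {y. y \<bullet> \<omega> < x \<bullet> \<omega>} \<inter> ball x \<rho>" by (auto simp: F_def P_def)
    qed simp
    moreover have "F - P - ball x \<rho> = {}" "P - F - ball x \<rho> = P - E - ball x \<rho>" by (auto simp: F_def)
    ultimately have "emeasure (kernel_measure s x) (P - E - ball x \<rho>) = 0" by simp
    moreover have "P - E - ball x \<rho> \<in> sets lebesgue" using P E by (intro sets.Diff) auto
    ultimately show ?thesis using \<rho> by (intro null_sets_kernel_measure[of _ x s]) auto
  qed
  \<comment> \<open>Shrinking the ball through the radii \<open>1 / Suc n\<close> leaves only the
    point \<open>x\<close> uncovered.\<close>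
  have "P - E \<subseteq> {x} \<union> (\<Union>n::nat. P - E - ball x (1 / Suc n))"
  proof
    fix y assume y: "y \<in> P - E"
    show "y \<in> {x} \<union> (\<Union>n::nat. P - E - ball x (1 / Suc n))"
    proof (cases "y = x")
      case False
      then obtain n where "1 / real (Suc n) < dist x y"
        using nat_approx_posE[of "dist x y"] by auto
      then show ?thesis using y by (auto intro!: exI[of _ n])
    qed simp
  qed
  moreover have "{x} \<union> (\<Union>n::nat. P - E - ball x (1 / Suc n)) \<in> null_sets lebesgue"
    by (intro null_sets.Un null_sets_UN null) (auto simp: null_sets_completion_iff[symmetric] intro: null_sets_completionI)
  ultimately have "P - E \<in> null_sets lebesgue" using null_sets_lebesgue_subset by blast
  then show ?thesis unfolding ess_equal_def P_def[symmetric] using EP by (rule_tac null_sets.Un)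
qed

text \<open>The highest translate of the barrier that meets the support touches it from above. If it
  were too high, the contact point would lie over \<open>\<bar>p\<bar> > 1\<close>, where
  \<open>no_touching\<close> excludes it.\<close>

lemma below_barrier:
  fixes e \<omega> :: "real^2"
  assumes E: "E \<in> sets lebesgue" and visc: "visc_frac_curv_nonpos (2*b) E"
    and on: "norm e = 1" "norm \<omega> = 1" "e \<bullet> \<omega> = 0"
    and b: "0 < b" "b < 1/2" and r: "0 < r" "r < 1" and t: "0 < t" and \<theta>: "0 < \<theta>"
    and \<theta>t: "\<theta> \<le> sqrt (1 + (t / r)\<^sup>2) powr (-(2+2*b))"
    and gap: "\<And>X. 0 < X \<Longrightarrow> mass_above b r X < ennreal \<theta> * mass_below b r X"
    and M: "\<And>y. y \<in> ess_supp E \<Longrightarrow> y \<bullet> \<omega> \<le> M"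
    and core: "\<And>y. y \<in> ess_supp E \<Longrightarrow> \<bar>y \<bullet> e\<bar> \<le> 1 \<Longrightarrow> y \<bullet> \<omega> \<le> M - \<delta>"
    and z: "z \<in> ess_supp E"
  shows "z \<bullet> \<omega> \<le> M - \<delta> + t * \<bar>z \<bullet> e\<bar> powr b"
proof (rule ccontr)
  assume neg: "\<not> ?thesis"
  \<comment> \<open>The value \<open>f y\<close> is the height at which the barrier must be placed
    to pass through \<open>y\<close>; a maximizer of \<open>f\<close> is a first contact
    point.\<close>
  define f where "f = (\<lambda>y. y \<bullet> \<omega> - t * \<bar>y \<bullet> e\<bar> powr b)"
  have cf: "continuous_on UNIV f" unfolding f_def
    using b by (intro continuous_intros continuous_on_powr') auto
  define K where "K = ess_supp E \<inter> {y. f z \<le> f y}"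
  have "closed K" unfolding K_def
    by (intro closed_Int closed_ess_supp E closed_Collect_le continuous_intros cf)
  moreover have "bounded K"
  proof -
    \<comment> \<open>Points of \<open>K\<close> have height at most \<open>M\<close>, so the
      growing term \<open>t * \<bar>y \<bullet> e\<bar> powr b\<close> cannot exceed
      \<open>M - f z\<close>. This makes the superlevel set bounded along the line.\<close>
    define B where "B = ((M - f z) / t) powr (1/b)"
    have "norm y \<le> B + (\<bar>M\<bar> + \<bar>f z\<bar>)" if y: "y \<in> K" for y
    proof -
      have yM: "y \<bullet> \<omega> \<le> M" and yf: "f z \<le> y \<bullet> \<omega> - t * \<bar>y \<bullet> e\<bar> powr b"
        using y M by (auto simp: K_def f_def)
      have "0 \<le> t * \<bar>y \<bullet> e\<bar> powr b" using t by simp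
      then have "\<bar>y \<bullet> \<omega>\<bar> \<le> \<bar>M\<bar> + \<bar>f z\<bar>" using yM yf by linarith
      moreover have "\<bar>y \<bullet> e\<bar> powr b \<le> (M - f z) / t" using yM yf t by (simp add: field_simps)
      then have "(\<bar>y \<bullet> e\<bar> powr b) powr (1/b) \<le> B" unfolding B_def using b by (intro powr_mono2) auto
      then have "\<bar>y \<bullet> e\<bar> \<le> B" using b by (simp add: powr_powr)
      moreover have "norm y \<le> \<bar>y \<bullet> e\<bar> + \<bar>y \<bullet> \<omega>\<bar>"
        using norm_triangle_ineq[of "(y \<bullet> e) *\<^sub>R e" "(y \<bullet> \<omega>) *\<^sub>R \<omega>"] frame_expansion[OF on, of y] on by simp
      ultimately show ?thesis by linarith
    qed
    then show ?thesis unfolding bounded_iff by blast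
  qed
  ultimately have "compact K" by (simp add: compact_eq_bounded_closed)
  moreover have "K \<noteq> {}" using z by (auto simp: K_def)
  ultimately obtain x where x: "x \<in> K" "\<And>y. y \<in> K \<Longrightarrow> f y \<le> f x"
    using continuous_attains_sup[of K f] cf continuous_on_subset[OF cf] by blast
  have xE: "x \<in> ess_supp E" and fx: "f z \<le> f x" using x by (auto simp: K_def)
  have max: "f y \<le> f x" if "y \<in> ess_supp E" for y
    using x that fx by (cases "f z \<le> f y") (auto simp: K_def)
  then have below: "y \<bullet> \<omega> \<le> x \<bullet> \<omega> + t * (\<bar>y \<bullet> e\<bar> powr b - \<bar>x \<bullet> e\<bar> powr b)" if "y \<in> ess_supp E" for y
    using that by (force simp: f_def algebra_simps)
  \<comment> \<open>The contact point is higher than \<open>core\<close> permits over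
    \<open>\<bar>p\<bar> \<le> 1\<close>.\<close>
  have "M - \<delta> < f x" using neg fx by (simp add: f_def)
  moreover have "f x \<le> x \<bullet> \<omega>" using t by (simp add: f_def)
  ultimately have xe: "1 < \<bar>x \<bullet> e\<bar>" using core[OF xE] by force
  show False
  proof (cases "0 \<le> x \<bullet> e")
    case True
    show False
      by (rule no_touching[OF E visc xE on b r t \<theta> \<theta>t _ gap]) (use xe True below in auto)
  next
    case False
    \<comment> \<open>The barrier is even, so reversing \<open>e\<close> makes the contact abscissa
      positive.\<close>
    have on': "norm (-e) = 1" "(-e) \<bullet> \<omega> = 0" using on by auto
    show False
      by (rule no_touching[OF E visc xE on'(1) on(2) on'(2) b r t \<theta> \<theta>t _ gap]) (use xe False below in auto)
  qed
qed

theorem theorem3p1: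
  fixes s :: real and E :: "(real^2) set"
  assumes "0 < s" and "s < 1"
    and "E \<in> sets lebesgue"
    and "\<not> ess_equal E {}"
    and "\<exists>P. half_plane P \<and> ess_subset E P"
    and "visc_frac_curv_nonpos s E"
  shows "\<exists>P. half_plane P \<and> ess_equal E P"
proof -
  note E = assms(3)
  obtain \<omega> :: "real^2" and a where \<omega>: "norm \<omega> = 1" and Ea: "ess_subset E {x. x \<bullet> \<omega> < a}"
    using assms(5) unfolding half_plane_def by blast
  have "ess_subset E {x. x \<bullet> \<omega> \<le> a}"
    using Ea unfolding ess_subset_def by (rule null_sets_lebesgue_subset) auto
  moreover have "closed {x. x \<bullet> \<omega> \<le> a}" by (intro closed_Collect_le continuous_intros)
  ultimately have supp_a: "ess_supp E \<subseteq> {x. x \<bullet> \<omega> \<le> a}" by (rule ess_supp_subset)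
  \<comment> \<open>The empty set satisfies the viscosity condition vacuously, and
    \<open>assms(4)\<close> rules it out here. Without points in the support the supremum
    \<open>M\<close> would be meaningless.\<close>
  have ne: "ess_supp E \<noteq> {}"
    using ess_subset_ess_supp[OF E] assms(4) by (auto simp: ess_subset_def ess_equal_def)
  define M where "M = (SUP y\<in>ess_supp E. y \<bullet> \<omega>)"
  have bdd: "bdd_above ((\<lambda>y. y \<bullet> \<omega>) ` ess_supp E)" using supp_a by (intro bdd_aboveI2[of _ _ a]) auto
  have M: "y \<bullet> \<omega> \<le> M" if "y \<in> ess_supp E" for y
    unfolding M_def using that bdd by (intro cSUP_upper)
  show ?thesis
  proof (cases "\<exists>x\<in>ess_supp E. x \<bullet> \<omega> = M")
    case True
    then obtain x where x: "x \<in> ess_supp E" "x \<bullet> \<omega> = M" by blast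
    have "\<omega> \<noteq> 0" using \<omega> by auto
    then have "ess_equal E {y. y \<bullet> \<omega> < x \<bullet> \<omega>}"
      using M x by (intro half_plane_if_touching[OF E assms(6,1)]) auto
    then show ?thesis using \<omega> unfolding half_plane_def by blast
  next
    case False
    then have lt: "y \<bullet> \<omega> < M" if "y \<in> ess_supp E" for y using M[OF that] that by (auto simp: less_le)
    define e :: "real^2" where "e = vector [- \<omega>$2, \<omega>$1]"
    have on: "norm e = 1" "norm \<omega> = 1" "e \<bullet> \<omega> = 0"
      using \<omega> by (auto simp: e_def norm_eq_1 inner_vec_def sum_2 algebra_simps)
    \<comment> \<open>With this exponent the difference of the integrands compared in
      \<open>profile_gap\<close> is a perfect square times a positive kernel.\<close>
    define b where "b = s / 2"
    have b: "0 < b" "b < 1/2" and s: "s = 2 * b" using assms(1,2) by (auto simp: b_def)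
    obtain r \<theta> where r: "0 < r" "r < 1" and \<theta>: "0 < \<theta>" "\<theta> < 1" and gap: "\<And>X. 0 < X \<Longrightarrow> mass_above b r X < ennreal \<theta> * mass_below b r X"
      using barrier_gap[OF b] by blast
    obtain \<delta> where \<delta>: "0 < \<delta>" and core: "\<And>y. y \<in> ess_supp E \<Longrightarrow> \<bar>y \<bullet> e\<bar> \<le> 1 \<Longrightarrow> y \<bullet> \<omega> \<le> M - \<delta>"
    proof -
      \<comment> \<open>Only heights within 1 of \<open>M\<close> are kept, which makes the set
        compact. Points below this window account for the minimum with 1 in the choice of
        \<open>\<delta>\<close>.\<close>
      define K where "K = ess_supp E \<inter> ({y. \<bar>y \<bullet> e\<bar> \<le> 1} \<inter> {y. M - 1 \<le> y \<bullet> \<omega>})"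
      have "closed K" unfolding K_def
        by (intro closed_Int closed_ess_supp E closed_Collect_le continuous_intros)
      moreover have "bounded K"
      proof -
        have "norm y \<le> 1 + (\<bar>M\<bar> + 1)" if y: "y \<in> K" for y
        proof -
          have "\<bar>y \<bullet> \<omega>\<bar> \<le> \<bar>M\<bar> + 1" "\<bar>y \<bullet> e\<bar> \<le> 1" using M[of y] y by (auto simp: K_def)
          moreover have "norm y \<le> \<bar>y \<bullet> e\<bar> + \<bar>y \<bullet> \<omega>\<bar>"
            using norm_triangle_ineq[of "(y \<bullet> e) *\<^sub>R e" "(y \<bullet> \<omega>) *\<^sub>R \<omega>"] frame_expansion[OF on, of y] on by simp
          ultimately show ?thesis by linarith
        qed
        then show ?thesis unfolding bounded_iff by blast
      qed
      ultimately have K: "compact K" by (simp add: compact_eq_bounded_closed)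
      show ?thesis
      proof (cases "K = {}")
        case True
        show ?thesis by (rule that[of 1]) (use True in \<open>auto simp: K_def\<close>)
      next
        case False
        have "continuous_on K (\<lambda>y. y \<bullet> \<omega>)" by (intro continuous_intros)
        then obtain z where z: "z \<in> K" "\<And>y. y \<in> K \<Longrightarrow> y \<bullet> \<omega> \<le> z \<bullet> \<omega>"
          using continuous_attains_sup[OF K False] by blast
        have zM: "z \<bullet> \<omega> < M" using z(1) lt by (auto simp: K_def)
        show ?thesis
        proof (rule that[of "min 1 (M - z \<bullet> \<omega>)"])
          show "0 < min 1 (M - z \<bullet> \<omega>)" using zM by simp
          fix y assume y: "y \<in> ess_supp E" "\<bar>y \<bullet> e\<bar> \<le> 1"
          show "y \<bullet> \<omega> \<le> M - min 1 (M - z \<bullet> \<omega>)"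
          proof (cases "M - 1 \<le> y \<bullet> \<omega>")
            case True
            then have "y \<bullet> \<omega> \<le> z \<bullet> \<omega>" using y by (intro z(2)) (auto simp: K_def)
            then show ?thesis by linarith
          qed linarith
        qed
      qed
    qed
    \<comment> \<open>As \<open>t\<close> tends to 0 the distortion factor tends to 1, so it
      eventually exceeds the fixed \<open>\<theta> < 1\<close>.\<close>
    have "((\<lambda>t. sqrt (1 + (t / r)\<^sup>2) powr (-(2+2*b))) \<longlongrightarrow> sqrt (1 + (0 / r)\<^sup>2) powr (-(2+2*b))) (at_right 0)"
      using r by (intro tendsto_intros) auto
    then have ev: "\<forall>\<^sub>F t in at_right 0. \<theta> < sqrt (1 + (t / r)\<^sup>2) powr (-(2+2*b))"
      using \<theta> by (intro order_tendstoD(1)[rotated]) auto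
    have "y \<bullet> \<omega> \<le> M - \<delta>" if y: "y \<in> ess_supp E" for y
    proof -
      \<comment> \<open>For a fixed point \<open>y\<close> the barriers descend to the constant
        \<open>M - \<delta>\<close>, which thus bounds the whole support.\<close>
      have "((\<lambda>t. M - \<delta> + t * \<bar>y \<bullet> e\<bar> powr b) \<longlongrightarrow> M - \<delta> + 0 * \<bar>y \<bullet> e\<bar> powr b) (at_right 0)"
        by (intro tendsto_intros)
      moreover have "\<forall>\<^sub>F t in at_right 0. y \<bullet> \<omega> \<le> M - \<delta> + t * \<bar>y \<bullet> e\<bar> powr b"
        using ev eventually_at_right_less[of 0]
      proof eventually_elim
        case (elim t)
        show ?case
          using below_barrier[OF E assms(6)[unfolded s] on b r elim(2) \<theta>(1) less_imp_le[OF elim(1)] gap M core y] .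
      qed
      ultimately have "y \<bullet> \<omega> \<le> M - \<delta> + 0 * \<bar>y \<bullet> e\<bar> powr b" by (rule tendsto_lowerbound) simp
      then show ?thesis by simp
    qed
    then have "M \<le> M - \<delta>" unfolding M_def using ne by (intro cSUP_least)
    then show ?thesis using \<delta> by simp
  qed
qed

end
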